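(* Let $\mathcal{A}$ be an essentially small abelian length category, let $[\mathcal{U},\mathcal{T}]$ be an interval in $\mathsf{tors}\,\mathcal{A}$, and set $\mathcal{W}:=\mathcal{U}^\perp\cap\mathcal{T}$. Then the following conditions are equivalent: (a) $\mathcal{W}$ is a wide subcategory of $\mathcal{A}$; (b) $\mathcal{W}\in\mathsf{Serre}(\mathsf{W}_L(\mathcal{T}))$; (c) $\mathcal{W}\in\mathsf{Serre}(\mathsf{W}_R(\mathcal{U}^\perp))$; (d) $\mathcal{W}=\mathsf{W}_R(\mathcal{U}^\perp)\cap\mathsf{W}_L(\mathcal{T})$.
   Context: All subcategories are full and closed under isomorphism. An abelian length category is an abelian category in which every object has a finite composition series. For a subcategory $\mathcal{X}\subseteq\mathcal{A}$: $\mathcal{X}^\perp=\{Y\mid \mathrm{Hom}_{\mathcal{A}}(X,Y)=0\ \forall X\in\mathcal{X}\}$. A torsion class (resp. torsion-free class) is a subcategory closed under extensions and factor objects (resp. subobjects). $\mathsf{tors}\,\mathcal{A}$ is the set of torsion classes, ordered by inclusion. For $\mathcal{U}\subseteq\mathcal{T}$ in $\mathsf{tors}\,\mathcal{A}$, $[\mathcal{U},\mathcal{T}]$ denotes the interval of torsion classes $\mathcal{V}$ with $\mathcal{U}\subseteq\mathcal{V}\subseteq\mathcal{T}$. For $\mathcal{U}\in\mathsf{tors}\,\mathcal{A}$, $\mathcal{U}^\perp$ is a torsion-free class. A wide subcategory is one closed under kernels, cokernels and extensions in $\mathcal{A}$; it is itself an abelian length category. For a torsion class $\mathcal{T}$ and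 a torsion-free class $\mathcal{F}$ put $$\mathsf{W}_L(\mathcal{T})=\{X\in\mathcal{T}\mid\text{for all }Y\in\mathcal{T}\text{ and all }g\colon Y\to X,\ \mathrm{Ker}\,g\in\mathcal{T}\},$$ $$\mathsf{W}_R(\mathcal{F})=\{X\in\mathcal{F}\mid\text{for all }Y\in\mathcal{F}\text{ and all }f\colon X\to Y,\ \mathrm{Coker}\,f\in\mathcal{F}\}.$$ Both are known to be wide subcategories of $\mathcal{A}$. For a wide subcategory $\mathcal{W}'$, $\mathsf{Serre}(\mathcal{W}')$ is the set of Serre subcategories of the abelian category $\mathcal{W}'$ (closed under extensions, factor objects and subobjects in $\mathcal{W}'$). *)

theory Defs
  imports "HOL-Algebra.Group"
begin

section \<open>Categories\<close>

text \<open>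
  Every category below has a set of objects and a set of arrows, so it is small relative to HOL,
  and the torsion classes form a set without further assumptions.  An essentially small category
  is covered through any small category equivalent to it.
\<close>

record ('o, 'a) category =
  Obj :: "'o set"
  Arr :: "'a set"
  Dom :: "'a \<Rightarrow> 'o"
  Cod :: "'a \<Rightarrow> 'o"
  Ident :: "'o \<Rightarrow> 'a"
  Comp :: "'a \<Rightarrow> 'a \<Rightarrow> 'a"  (infixr \<open>\<odot>\<index>\<close> 70)

record ('o, 'a) preadditive = "('o, 'a) category" +
  Add :: "'a \<Rightarrow> 'a \<Rightarrow> 'a"  (infixl \<open>\<boxplus>\<index>\<close> 65)
  ZeroArr :: "'o \<Rightarrow> 'o \<Rightarrow> 'a"

definition Hom :: "('o, 'a, 'm) category_scheme \<Rightarrow> 'o \<Rightarrow> 'o \<Rightarrow> 'a set" where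
  "Hom C X Y = {f \<in> Arr C. Dom C f = X \<and> Cod C f = Y}"

locale category =
  fixes C :: "('o, 'a, 'm) category_scheme" (structure)
  assumes Dom_in_Obj: "f \<in> Arr C \<Longrightarrow> Dom C f \<in> Obj C"
    and Cod_in_Obj: "f \<in> Arr C \<Longrightarrow> Cod C f \<in> Obj C"
    and Ident_in_Hom: "X \<in> Obj C \<Longrightarrow> Ident C X \<in> Hom C X X"
    and Comp_in_Hom: "f \<in> Hom C X Y \<Longrightarrow> g \<in> Hom C Y Z \<Longrightarrow> g \<odot> f \<in> Hom C X Z"
    and Comp_Ident: "f \<in> Hom C X Y \<Longrightarrow> f \<odot> Ident C X = f"
    and Ident_Comp: "f \<in> Hom C X Y \<Longrightarrow> Ident C Y \<odot> f = f"
    and Comp_assoc: "f \<in> Hom C W X \<Longrightarrow> g \<in> Hom C X Y \<Longrightarrow> h \<in> Hom C Y Z \<Longrightarrow>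
      (h \<odot> g) \<odot> f = h \<odot> (g \<odot> f)"

definition monic :: "('o, 'a, 'm) category_scheme \<Rightarrow> 'a \<Rightarrow> bool" where
  "monic C m \<longleftrightarrow> m \<in> Arr C \<and>
    (\<forall>X. \<forall>f \<in> Hom C X (Dom C m). \<forall>g \<in> Hom C X (Dom C m).
      m \<odot>\<^bsub>C\<^esub> f = m \<odot>\<^bsub>C\<^esub> g \<longrightarrow> f = g)"

definition epic :: "('o, 'a, 'm) category_scheme \<Rightarrow> 'a \<Rightarrow> bool" where
  "epic C e \<longleftrightarrow> e \<in> Arr C \<and>
    (\<forall>X. \<forall>f \<in> Hom C (Cod C e) X. \<forall>g \<in> Hom C (Cod C e) X.
      f \<odot>\<^bsub>C\<^esub> e = g \<odot>\<^bsub>C\<^esub> e \<longrightarrow> f = g)"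

definition isomorphism :: "('o, 'a, 'm) category_scheme \<Rightarrow> 'a \<Rightarrow> bool" where
  "isomorphism C f \<longleftrightarrow> f \<in> Arr C \<and>
    (\<exists>g \<in> Hom C (Cod C f) (Dom C f).
      g \<odot>\<^bsub>C\<^esub> f = Ident C (Dom C f) \<and> f \<odot>\<^bsub>C\<^esub> g = Ident C (Cod C f))"

definition zero_object :: "('o, 'a, 'm) category_scheme \<Rightarrow> 'o \<Rightarrow> bool" where
  "zero_object C Z \<longleftrightarrow> Z \<in> Obj C \<and>
    (\<forall>X \<in> Obj C. (\<exists>!f. f \<in> Hom C Z X) \<and> (\<exists>!f. f \<in> Hom C X Z))"

definition simple_object :: "('o, 'a, 'm) category_scheme \<Rightarrow> 'o \<Rightarrow> bool" where
  "simple_object C S \<longleftrightarrow> S \<in> Obj C \<and> \<not> zero_object C S \<and>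
    (\<forall>m. monic C m \<and> Cod C m = S \<longrightarrow> zero_object C (Dom C m) \<or> isomorphism C m)"


section \<open>Abelian length categories\<close>

locale preadditive_category = category C
  for C :: "('o, 'a, 'm) preadditive_scheme" (structure) +
  assumes Hom_comm_group: "X \<in> Obj C \<Longrightarrow> Y \<in> Obj C \<Longrightarrow>
      comm_group \<lparr>carrier = Hom C X Y, monoid.mult = Add C, one = ZeroArr C X Y\<rparr>"
    and Comp_Add: "f \<in> Hom C X Y \<Longrightarrow> g \<in> Hom C Y Z \<Longrightarrow> h \<in> Hom C Y Z \<Longrightarrow>
      (g \<boxplus> h) \<odot> f = (g \<odot> f) \<boxplus> (h \<odot> f)"
    and Add_Comp: "f \<in> Hom C X Y \<Longrightarrow> g \<in> Hom C X Y \<Longrightarrow> h \<in> Hom C Y Z \<Longrightarrow>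
      h \<odot> (f \<boxplus> g) = (h \<odot> f) \<boxplus> (h \<odot> g)"

definition biproduct ::
  "('o, 'a, 'm) preadditive_scheme \<Rightarrow> 'o \<Rightarrow> 'o \<Rightarrow> 'o \<Rightarrow> 'a \<Rightarrow> 'a \<Rightarrow> 'a \<Rightarrow> 'a \<Rightarrow> bool" where
  "biproduct C X Y P i j p q \<longleftrightarrow> P \<in> Obj C \<and>
    i \<in> Hom C X P \<and> j \<in> Hom C Y P \<and> p \<in> Hom C P X \<and> q \<in> Hom C P Y \<and>
    p \<odot>\<^bsub>C\<^esub> i = Ident C X \<and> q \<odot>\<^bsub>C\<^esub> j = Ident C Y \<and>
    p \<odot>\<^bsub>C\<^esub> j = ZeroArr C Y X \<and> q \<odot>\<^bsub>C\<^esub> i = ZeroArr C X Y \<and>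
    (i \<odot>\<^bsub>C\<^esub> p) \<boxplus>\<^bsub>C\<^esub> (j \<odot>\<^bsub>C\<^esub> q) = Ident C P"

locale additive_category = preadditive_category +
  assumes ex_zero_object: "\<exists>Z. zero_object C Z"
    and ex_biproduct: "X \<in> Obj C \<Longrightarrow> Y \<in> Obj C \<Longrightarrow> \<exists>P i j p q. biproduct C X Y P i j p q"

definition is_kernel :: "('o, 'a, 'm) preadditive_scheme \<Rightarrow> 'a \<Rightarrow> 'a \<Rightarrow> bool" where
  "is_kernel C f k \<longleftrightarrow> f \<in> Arr C \<and> k \<in> Arr C \<and> Cod C k = Dom C f \<and>
    f \<odot>\<^bsub>C\<^esub> k = ZeroArr C (Dom C k) (Cod C f) \<and>
    (\<forall>X. \<forall>h \<in> Hom C X (Dom C f). f \<odot>\<^bsub>C\<^esub> h = ZeroArr C X (Cod C f) \<longrightarrow>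
      (\<exists>!u. u \<in> Hom C X (Dom C k) \<and> k \<odot>\<^bsub>C\<^esub> u = h))"

definition is_cokernel :: "('o, 'a, 'm) preadditive_scheme \<Rightarrow> 'a \<Rightarrow> 'a \<Rightarrow> bool" where
  "is_cokernel C f c \<longleftrightarrow> f \<in> Arr C \<and> c \<in> Arr C \<and> Dom C c = Cod C f \<and>
    c \<odot>\<^bsub>C\<^esub> f = ZeroArr C (Dom C f) (Cod C c) \<and>
    (\<forall>X. \<forall>h \<in> Hom C (Cod C f) X. h \<odot>\<^bsub>C\<^esub> f = ZeroArr C (Dom C f) X \<longrightarrow>
      (\<exists>!u. u \<in> Hom C (Cod C c) X \<and> u \<odot>\<^bsub>C\<^esub> c = h))"

locale abelian_category = additive_category +
  assumes ex_kernel: "f \<in> Arr C \<Longrightarrow> \<exists>k. is_kernel C f k"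
    and ex_cokernel: "f \<in> Arr C \<Longrightarrow> \<exists>c. is_cokernel C f c"
    and monic_normal: "monic C m \<Longrightarrow> \<exists>f. is_kernel C f m"
    and epic_normal: "epic C e \<Longrightarrow> \<exists>f. is_cokernel C f e"

text \<open>
  A composition series \<open>0 = X\<^sub>0 \<subset> X\<^sub>1 \<subset> \<dots> \<subset> X\<^sub>n = X\<close> is given by its terms \<open>Xs i\<close> and the
  inclusions \<open>ms i : X\<^sub>i \<rightarrow> X\<^sub>i\<^sub>+\<^sub>1\<close>.
\<close>

definition composition_series ::
  "('o, 'a, 'm) preadditive_scheme \<Rightarrow> 'o \<Rightarrow> nat \<Rightarrow> (nat \<Rightarrow> 'o) \<Rightarrow> (nat \<Rightarrow> 'a) \<Rightarrow> bool" where
  "composition_series C X n Xs ms \<longleftrightarrow> zero_object C (Xs 0) \<and> Xs n = X \<and>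
    (\<forall>i<n. ms i \<in> Hom C (Xs i) (Xs (Suc i)) \<and> monic C (ms i) \<and>
      (\<exists>q. is_cokernel C (ms i) q \<and> simple_object C (Cod C q)))"

locale abelian_length_category = abelian_category +
  assumes ex_composition_series: "X \<in> Obj C \<Longrightarrow> \<exists>n Xs ms. composition_series C X n Xs ms"


section \<open>Subcategories\<close>

text \<open>
  A full subcategory is given by its set of objects.  Requiring it to be nonempty makes every
  class of subcategories below contain the zero objects.
\<close>

definition subcategory :: "('o, 'a, 'm) category_scheme \<Rightarrow> 'o set \<Rightarrow> bool" where
  "subcategory C S \<longleftrightarrow> S \<subseteq> Obj C \<and> S \<noteq> {} \<and>
    (\<forall>f. isomorphism C f \<and> Dom C f \<in> S \<longrightarrow> Cod C f \<in> S)"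

definition full_subcategory ::
  "('o, 'a, 'm) category_scheme \<Rightarrow> 'o set \<Rightarrow> ('o, 'a, 'm) category_scheme" where
  "full_subcategory C S =
    C\<lparr>Obj := S, Arr := {f \<in> Arr C. Dom C f \<in> S \<and> Cod C f \<in> S}\<rparr>"

definition short_exact :: "('o, 'a, 'm) preadditive_scheme \<Rightarrow> 'a \<Rightarrow> 'a \<Rightarrow> bool" where
  "short_exact C f g \<longleftrightarrow> is_kernel C g f \<and> is_cokernel C f g"

definition closed_under_extensions :: "('o, 'a, 'm) preadditive_scheme \<Rightarrow> 'o set \<Rightarrow> bool" where
  "closed_under_extensions C S \<longleftrightarrow>
    (\<forall>f g. short_exact C f g \<and> Dom C f \<in> S \<and> Cod C g \<in> S \<longrightarrow> Cod C f \<in> S)"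

definition closed_under_factors :: "('o, 'a, 'm) category_scheme \<Rightarrow> 'o set \<Rightarrow> bool" where
  "closed_under_factors C S \<longleftrightarrow> (\<forall>e. epic C e \<and> Dom C e \<in> S \<longrightarrow> Cod C e \<in> S)"

definition closed_under_subobjects :: "('o, 'a, 'm) category_scheme \<Rightarrow> 'o set \<Rightarrow> bool" where
  "closed_under_subobjects C S \<longleftrightarrow> (\<forall>m. monic C m \<and> Cod C m \<in> S \<longrightarrow> Dom C m \<in> S)"

definition closed_under_kernels :: "('o, 'a, 'm) preadditive_scheme \<Rightarrow> 'o set \<Rightarrow> bool" where
  "closed_under_kernels C S \<longleftrightarrow>
    (\<forall>f k. Dom C f \<in> S \<and> Cod C f \<in> S \<and> is_kernel C f k \<longrightarrow> Dom C k \<in> S)"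

definition closed_under_cokernels :: "('o, 'a, 'm) preadditive_scheme \<Rightarrow> 'o set \<Rightarrow> bool" where
  "closed_under_cokernels C S \<longleftrightarrow>
    (\<forall>f c. Dom C f \<in> S \<and> Cod C f \<in> S \<and> is_cokernel C f c \<longrightarrow> Cod C c \<in> S)"

definition tors :: "('o, 'a, 'm) preadditive_scheme \<Rightarrow> 'o set set" where
  "tors C = {T. subcategory C T \<and> closed_under_extensions C T \<and> closed_under_factors C T}"

definition wide :: "('o, 'a, 'm) preadditive_scheme \<Rightarrow> 'o set \<Rightarrow> bool" where
  "wide C W \<longleftrightarrow> subcategory C W \<and> closed_under_kernels C W \<and> closed_under_cokernels C W \<and>
    closed_under_extensions C W"

definition Serre :: "('o, 'a, 'm) preadditive_scheme \<Rightarrow> 'o set set" where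
  "Serre C = {S. subcategory C S \<and> closed_under_extensions C S \<and> closed_under_factors C S \<and>
    closed_under_subobjects C S}"

text \<open>
  Extensions, factor objects and subobjects are those of the category \<open>W\<close>, with monomorphisms,
  epimorphisms, kernels and cokernels formed inside \<open>W\<close>.
\<close>

definition Serre_in :: "('o, 'a, 'm) preadditive_scheme \<Rightarrow> 'o set \<Rightarrow> 'o set set" where
  "Serre_in C W = Serre (full_subcategory C W)"

definition right_perp :: "('o, 'a, 'm) preadditive_scheme \<Rightarrow> 'o set \<Rightarrow> 'o set" where
  "right_perp C S = {Y \<in> Obj C. \<forall>X \<in> S. Hom C X Y = {ZeroArr C X Y}}"

definition W_L :: "('o, 'a, 'm) preadditive_scheme \<Rightarrow> 'o set \<Rightarrow> 'o set" where
  "W_L C T = {X \<in> T. \<forall>Y \<in> T. \<forall>g \<in> Hom C Y X. \<forall>k. is_kernel C g k \<longrightarrow> Dom C k \<in> T}"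

definition W_R :: "('o, 'a, 'm) preadditive_scheme \<Rightarrow> 'o set \<Rightarrow> 'o set" where
  "W_R C F = {X \<in> F. \<forall>Y \<in> F. \<forall>f \<in> Hom C X Y. \<forall>c. is_cokernel C f c \<longrightarrow> Cod C c \<in> F}"

end

theory Submission
  imports Defs
begin

text \<open>
  Write \<open>F\<close> for the right perpendicular of \<open>U\<close>.  Suppose that \<open>W = F \<inter> T\<close> is wide, and let
  \<open>g : Y \<rightarrow> X\<close> with \<open>Y\<close> in \<open>T\<close> and \<open>X\<close> in \<open>W\<close>.  The \<open>U\<close>-torsion part \<open>A\<close> of \<open>Y\<close> is killed
  by \<open>g\<close>, the quotient \<open>Y/A\<close> lies in \<open>W\<close>, and the kernel of \<open>g\<close> is an extension of the kernel of
  \<open>Y/A \<rightarrow> X\<close>, which lies in \<open>W\<close>, by \<open>A\<close>; hence it is in \<open>T\<close>.  So \<open>W\<close> is contained in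
  \<open>W_L C T\<close>, and the dual argument, with the \<open>T\<close>-torsion part of an object of \<open>F\<close>, puts it into
  \<open>W_R C F\<close>.  Since \<open>W_L C T\<close> is closed under kernels and cokernels, monomorphisms, epimorphisms
  and short exact sequences formed in it are those of \<open>C\<close>, so being Serre in it can be tested
  in \<open>C\<close>.  Finite length is needed only for the existence of torsion parts.
\<close>

section \<open>Opposite categories\<close>

text \<open>Objects and arrows stay the same and only their reading is reversed, so
  \<open>opposite_opposite\<close> is an equality of records and the simplifier turns statements on
  kernels, monomorphisms and \<open>W_L\<close> into their duals. Half of the arguments below are
  obtained this way.\<close>

definition opposite :: "('o, 'a, 'm) preadditive_scheme \<Rightarrow> ('o, 'a, 'm) preadditive_scheme" where
  "opposite C = C\<lparr>Dom := Cod C, Cod := Dom C, Comp := \<lambda>g f. Comp C f g,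
    ZeroArr := \<lambda>X Y. ZeroArr C Y X\<rparr>"

lemma opposite_sel [simp]:
  "Obj (opposite C) = Obj C" "Arr (opposite C) = Arr C"
  "Dom (opposite C) = Cod C" "Cod (opposite C) = Dom C"
  "Ident (opposite C) = Ident C" "Comp (opposite C) g f = Comp C f g"
  "Add (opposite C) = Add C" "ZeroArr (opposite C) X Y = ZeroArr C Y X"
  by (simp_all add: opposite_def)

lemma opposite_opposite [simp]: "opposite (opposite C) = C"
  by (simp add: opposite_def)

lemma Hom_opposite [simp]: "Hom (opposite C) X Y = Hom C Y X"
  by (auto simp: Hom_def)

lemma monic_opposite [simp]: "monic (opposite C) m = epic C m"
  by (simp add: monic_def epic_def)

lemma epic_opposite [simp]: "epic (opposite C) m = monic C m"
  by (simp add: monic_def epic_def)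

lemma isomorphism_opposite [simp]: "isomorphism (opposite C) f = isomorphism C f"
  by (auto simp: isomorphism_def)

lemma zero_object_opposite [simp]: "zero_object (opposite C) Z = zero_object C Z"
  by (auto simp: zero_object_def)

lemma is_kernel_opposite [simp]: "is_kernel (opposite C) f k = is_cokernel C f k"
  by (simp add: is_kernel_def is_cokernel_def)

lemma is_cokernel_opposite [simp]: "is_cokernel (opposite C) f k = is_kernel C f k"
  by (simp add: is_kernel_def is_cokernel_def)

lemma biproduct_opposite [simp]:
  "biproduct (opposite C) X Y P i j p q = biproduct C X Y P p q i j"
  by (auto simp: biproduct_def)

lemma short_exact_opposite [simp]: "short_exact (opposite C) f g = short_exact C g f"
  by (auto simp: short_exact_def)

lemma isomorphism_inverse:
  assumes "isomorphism C f"
  obtains g where "isomorphism C g" "Dom C g = Cod C f" "Cod C g = Dom C f"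
  using assms by (fastforce simp: isomorphism_def Hom_def)

text \<open>Closure under isomorphism is stated from domain to codomain; passing to the inverse
  arrow reverses the direction.\<close>

lemma subcategory_opposite [simp]: "subcategory (opposite C) S = subcategory C S"
  unfolding subcategory_def by (simp, metis isomorphism_inverse)

lemma closed_under_extensions_opposite [simp]:
  "closed_under_extensions (opposite C) S = closed_under_extensions C S"
proof -
  \<comment> \<open>The middle object is named \<open>Cod C f\<close> in one category and
    \<open>Dom C g\<close> in the other; exactness identifies the two names.\<close>
  have "Cod C f = Dom C g" if "short_exact C f g" for f g
    using that by (simp add: short_exact_def is_kernel_def)
  then show ?thesis
    unfolding closed_under_extensions_def by (simp, metis)
qed

lemma closed_under_factors_opposite [simp]:
  "closed_under_factors (opposite C) S = closed_under_subobjects C S"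
  by (simp add: closed_under_factors_def closed_under_subobjects_def)

lemma closed_under_subobjects_opposite [simp]:
  "closed_under_subobjects (opposite C) S = closed_under_factors C S"
  by (simp add: closed_under_factors_def closed_under_subobjects_def)

lemma wide_opposite [simp]: "wide (opposite C) S = wide C S"
  by (auto simp: wide_def closed_under_kernels_def closed_under_cokernels_def)

lemma full_subcategory_opposite: "full_subcategory (opposite C) S = opposite (full_subcategory C S)"
  by (rule preadditive.equality) (auto simp: full_subcategory_def opposite_def fun_eq_iff)

lemma Serre_in_opposite [simp]: "Serre_in (opposite C) S = Serre_in C S"
  by (auto simp: Serre_in_def Serre_def full_subcategory_opposite)

lemma W_L_opposite: "W_L (opposite C) F = W_R C F"
  by (auto simp: W_L_def W_R_def)

lemma category_opposite: "category C \<Longrightarrow> category (opposite C)"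
  by (rule category.intro)
    (auto simp: category.Dom_in_Obj category.Cod_in_Obj category.Ident_in_Hom category.Comp_in_Hom
      category.Comp_Ident category.Ident_Comp category.Comp_assoc)

lemma preadditive_category_opposite:
  assumes "preadditive_category C"
  shows "preadditive_category (opposite C)"
proof -
  interpret preadditive_category C by fact
  show ?thesis
    by (intro preadditive_category.intro preadditive_category_axioms.intro
        category_opposite category_axioms)
      (simp_all add: Hom_comm_group Comp_Add Add_Comp)
qed

lemma additive_category_opposite:
  assumes "additive_category C"
  shows "additive_category (opposite C)"
proof -
  interpret additive_category C by fact
  show ?thesis
    by (intro additive_category.intro additive_category_axioms.intro
        preadditive_category_opposite preadditive_category_axioms)
      (use ex_zero_object ex_biproduct in \<open>simp_all, blast\<close>)
qed

lemma abelian_category_opposite: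
  assumes "abelian_category C"
  shows "abelian_category (opposite C)"
proof -
  interpret abelian_category C by fact
  show ?thesis
    by (intro abelian_category.intro abelian_category_axioms.intro
        additive_category_opposite additive_category_axioms)
      (simp_all add: ex_kernel ex_cokernel monic_normal epic_normal)
qed


section \<open>Preadditive and abelian categories\<close>

lemma HomI: "f \<in> Arr C \<Longrightarrow> f \<in> Hom C (Dom C f) (Cod C f)"
  by (simp add: Hom_def)

lemma Hom_sel: "f \<in> Hom C X Y \<Longrightarrow> f \<in> Arr C" "f \<in> Hom C X Y \<Longrightarrow> Dom C f = X"
  "f \<in> Hom C X Y \<Longrightarrow> Cod C f = Y"
  by (simp_all add: Hom_def)

lemma monicD:
  "monic C m \<Longrightarrow> m \<in> Hom C X Y \<Longrightarrow> f \<in> Hom C Z X \<Longrightarrow> g \<in> Hom C Z X \<Longrightarrow>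
    m \<odot>\<^bsub>C\<^esub> f = m \<odot>\<^bsub>C\<^esub> g \<Longrightarrow> f = g"
  by (auto simp: monic_def Hom_def)

lemma epicD:
  "epic C e \<Longrightarrow> e \<in> Hom C X Y \<Longrightarrow> f \<in> Hom C Y Z \<Longrightarrow> g \<in> Hom C Y Z \<Longrightarrow>
    f \<odot>\<^bsub>C\<^esub> e = g \<odot>\<^bsub>C\<^esub> e \<Longrightarrow> f = g"
  by (auto simp: epic_def Hom_def)

lemma monic_in_Hom: "monic C m \<Longrightarrow> m \<in> Hom C (Dom C m) (Cod C m)"
  by (simp add: monic_def Hom_def)

lemma epic_in_Hom: "epic C m \<Longrightarrow> m \<in> Hom C (Dom C m) (Cod C m)"
  by (simp add: epic_def Hom_def)

lemma kernel_in_Hom: "is_kernel C f k \<Longrightarrow> f \<in> Hom C X Y \<Longrightarrow> k \<in> Hom C (Dom C k) X"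
  by (simp add: is_kernel_def Hom_def)

lemma cokernel_in_Hom: "is_cokernel C f c \<Longrightarrow> f \<in> Hom C X Y \<Longrightarrow> c \<in> Hom C Y (Cod C c)"
  by (simp add: is_cokernel_def Hom_def)

lemma kernel_zero: "is_kernel C f k \<Longrightarrow> f \<in> Hom C X Y \<Longrightarrow> f \<odot>\<^bsub>C\<^esub> k = ZeroArr C (Dom C k) Y"
  by (simp add: is_kernel_def Hom_def)

lemma cokernel_zero: "is_cokernel C f c \<Longrightarrow> f \<in> Hom C X Y \<Longrightarrow> c \<odot>\<^bsub>C\<^esub> f = ZeroArr C X (Cod C c)"
  by (simp add: is_cokernel_def Hom_def)

lemma kernel_factor:
  assumes "is_kernel C f k" "f \<in> Hom C X Y" "h \<in> Hom C Z X" "f \<odot>\<^bsub>C\<^esub> h = ZeroArr C Z Y"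
  obtains u where "u \<in> Hom C Z (Dom C k)" "k \<odot>\<^bsub>C\<^esub> u = h"
proof -
  have "\<exists>u. u \<in> Hom C Z (Dom C k) \<and> k \<odot>\<^bsub>C\<^esub> u = h"
    using assms(1,3,4) unfolding is_kernel_def Hom_sel(2,3)[OF assms(2)] by blast
  then show thesis using that by blast
qed

lemma cokernel_factor:
  assumes "is_cokernel C f c" "f \<in> Hom C X Y" "h \<in> Hom C Y Z" "h \<odot>\<^bsub>C\<^esub> f = ZeroArr C X Z"
  obtains u where "u \<in> Hom C (Cod C c) Z" "u \<odot>\<^bsub>C\<^esub> c = h"
  using kernel_factor[of "opposite C" f c Y X h Z thesis] assms by simp

text \<open>A monomorphism \<open>k\<close> makes factorizations unique, so only their existence is
  left to check.\<close>

lemma is_kernelI: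
  assumes "f \<in> Hom C X Y" "k \<in> Hom C K X" "monic C k" "f \<odot>\<^bsub>C\<^esub> k = ZeroArr C K Y"
    and "\<And>Z h. h \<in> Hom C Z X \<Longrightarrow> f \<odot>\<^bsub>C\<^esub> h = ZeroArr C Z Y \<Longrightarrow> \<exists>u \<in> Hom C Z K. k \<odot>\<^bsub>C\<^esub> u = h"
  shows "is_kernel C f k"
  using assms monicD[OF assms(3,2)] by (auto simp: is_kernel_def Hom_sel)

text \<open>The apex is \<open>Dom C q\<close> and the common target is \<open>Cod C g\<close>; the
  conditions on Hom-sets force the ends of \<open>p\<close> and \<open>f\<close> to match. All
  corners are read off the arrows, so none is a separate argument.\<close>

definition is_pullback ::
  "('o, 'a, 'm) preadditive_scheme \<Rightarrow> 'a \<Rightarrow> 'a \<Rightarrow> 'a \<Rightarrow> 'a \<Rightarrow> bool" where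
  "is_pullback C f g p q \<longleftrightarrow> f \<in> Hom C (Dom C f) (Cod C g) \<and> g \<in> Hom C (Dom C g) (Cod C g) \<and>
    p \<in> Hom C (Dom C q) (Dom C f) \<and> q \<in> Hom C (Dom C q) (Dom C g) \<and>
    f \<odot>\<^bsub>C\<^esub> p = g \<odot>\<^bsub>C\<^esub> q \<and>
    (\<forall>Z. \<forall>x \<in> Hom C Z (Dom C f). \<forall>y \<in> Hom C Z (Dom C g). f \<odot>\<^bsub>C\<^esub> x = g \<odot>\<^bsub>C\<^esub> y \<longrightarrow>
      (\<exists>!u. u \<in> Hom C Z (Dom C q) \<and> p \<odot>\<^bsub>C\<^esub> u = x \<and> q \<odot>\<^bsub>C\<^esub> u = y))"

lemma is_pullback_commute:
  assumes "is_pullback C f g p q"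
  shows "is_pullback C g f q p"
proof -
  have "Cod C f = Cod C g" "Dom C p = Dom C q"
    using assms by (auto simp: is_pullback_def Hom_def)
  then show ?thesis
    using assms unfolding is_pullback_def by (simp add: conj_commute eq_commute[of "f \<odot>\<^bsub>C\<^esub> _"])
qed

section \<open>Preadditive categories: zero arrows, kernels and pullback squares\<close>

context preadditive_category
begin

lemma Hom_objs: "f \<in> Hom C X Y \<Longrightarrow> X \<in> Obj C" "f \<in> Hom C X Y \<Longrightarrow> Y \<in> Obj C"
  by (auto simp: Hom_def Dom_in_Obj Cod_in_Obj)

lemma zero_in_Hom: "X \<in> Obj C \<Longrightarrow> Y \<in> Obj C \<Longrightarrow> ZeroArr C X Y \<in> Hom C X Y"
  using monoid.one_closed[OF group.is_monoid[OF comm_group.axioms(2)[OF Hom_comm_group]]] by simp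

lemma add_in_Hom: "f \<in> Hom C X Y \<Longrightarrow> g \<in> Hom C X Y \<Longrightarrow> f \<boxplus> g \<in> Hom C X Y"
  using monoid.m_closed[OF group.is_monoid[OF comm_group.axioms(2)[OF Hom_comm_group]]] Hom_objs
  by simp

lemma zero_add: "f \<in> Hom C X Y \<Longrightarrow> ZeroArr C X Y \<boxplus> f = f"
  using monoid.l_one[OF group.is_monoid[OF comm_group.axioms(2)[OF Hom_comm_group]]] Hom_objs
  by simp

lemma add_zero: "f \<in> Hom C X Y \<Longrightarrow> f \<boxplus> ZeroArr C X Y = f"
  using monoid.r_one[OF group.is_monoid[OF comm_group.axioms(2)[OF Hom_comm_group]]] Hom_objs
  by simp

lemma add_right_cancel:
  "f \<in> Hom C X Y \<Longrightarrow> g \<in> Hom C X Y \<Longrightarrow> h \<in> Hom C X Y \<Longrightarrow> f \<boxplus> h = g \<boxplus> h \<Longrightarrow> f = g"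
  using group.right_cancel[OF comm_group.axioms(2)[OF Hom_comm_group], of X Y h f g] Hom_objs
  by simp

lemma ex_neg: "f \<in> Hom C X Y \<Longrightarrow> \<exists>n \<in> Hom C X Y. f \<boxplus> n = ZeroArr C X Y"
  using group.r_inv_ex[OF comm_group.axioms(2)[OF Hom_comm_group], of X Y f] Hom_objs
  by simp

lemma Comp_zero:
  assumes g: "g \<in> Hom C Y Z" and X: "X \<in> Obj C"
  shows "g \<odot> ZeroArr C X Y = ZeroArr C X Z"
proof -
  have z: "ZeroArr C X Y \<in> Hom C X Y" using zero_in_Hom X Hom_objs[OF g] by blast
  then have gz: "g \<odot> ZeroArr C X Y \<in> Hom C X Z" using g Comp_in_Hom by blast
  \<comment> \<open>By distributivity the composite equals its own double; cancelling one summand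
    leaves zero.\<close>
  have "(g \<odot> ZeroArr C X Y) \<boxplus> (g \<odot> ZeroArr C X Y) = ZeroArr C X Z \<boxplus> (g \<odot> ZeroArr C X Y)"
    using Add_Comp[OF z z g] zero_add[OF z] zero_add[OF gz] by simp
  then show ?thesis using add_right_cancel gz zero_in_Hom X Hom_objs[OF g] by blast
qed

lemma zero_Comp:
  assumes "f \<in> Hom C X Y" "Z \<in> Obj C" shows "ZeroArr C Y Z \<odot> f = ZeroArr C X Z"
  using preadditive_category.Comp_zero[OF preadditive_category_opposite[OF preadditive_category_axioms],
    of f Y X Z] assms by simp

text \<open>Differences test equality: subtracting two arrows that \<open>m\<close> identifies gives
  an arrow that \<open>m\<close> kills.\<close>

lemma monicI:
  assumes m: "m \<in> Hom C X Y"
    and 0: "\<And>Z h. h \<in> Hom C Z X \<Longrightarrow> m \<odot> h = ZeroArr C Z Y \<Longrightarrow> h = ZeroArr C Z X"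
  shows "monic C m"
proof -
  have "f = g" if fg: "f \<in> Hom C Z X" "g \<in> Hom C Z X" "m \<odot> f = m \<odot> g" for Z f g
  proof -
    obtain n where n: "n \<in> Hom C Z X" "g \<boxplus> n = ZeroArr C Z X"
      using ex_neg fg(2) by blast
    have "m \<odot> (f \<boxplus> n) = m \<odot> (g \<boxplus> n)"
      using Add_Comp[OF fg(1) n(1) m] Add_Comp[OF fg(2) n(1) m] fg(3) by simp
    then have "m \<odot> (f \<boxplus> n) = ZeroArr C Z Y"
      using n(2) m fg(1) by (simp add: Comp_zero Hom_objs)
    then have "f \<boxplus> n = g \<boxplus> n"
      using 0[of "f \<boxplus> n" Z] n fg by (simp add: add_in_Hom)
    then show ?thesis using add_right_cancel fg n by blast
  qed
  then show ?thesis unfolding monic_def Hom_sel(2)[OF m] using Hom_sel(1)[OF m] by blast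
qed

lemma epicI:
  assumes "e \<in> Hom C X Y"
    and "\<And>Z h. h \<in> Hom C Y Z \<Longrightarrow> h \<odot> e = ZeroArr C X Z \<Longrightarrow> h = ZeroArr C Y Z"
  shows "epic C e"
  using preadditive_category.monicI[OF preadditive_category_opposite[OF preadditive_category_axioms],
      of e Y X] assms by simp

lemma monic_zeroD:
  assumes "monic C m" "m \<in> Hom C X Y" "h \<in> Hom C Z X" "m \<odot> h = ZeroArr C Z Y"
  shows "h = ZeroArr C Z X"
  by (rule monicD[OF assms(1,2,3)]) (use assms in \<open>simp_all add: zero_in_Hom Hom_objs Comp_zero\<close>)

lemma epic_zeroD:
  assumes "epic C e" "e \<in> Hom C X Y" "h \<in> Hom C Y Z" "h \<odot> e = ZeroArr C X Z"
  shows "h = ZeroArr C Y Z"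
  by (rule epicD[OF assms(1,2,3)]) (use assms in \<open>simp_all add: zero_in_Hom Hom_objs zero_Comp\<close>)

lemma monic_Comp:
  assumes "monic C m" "monic C n" "m \<in> Hom C X Y" "n \<in> Hom C Y Z"
  shows "monic C (n \<odot> m)"
proof (rule monicI)
  show "n \<odot> m \<in> Hom C X Z" using assms Comp_in_Hom by blast
next
  fix V h assume "h \<in> Hom C V X" "(n \<odot> m) \<odot> h = ZeroArr C V Z"
  then show "h = ZeroArr C V X"
    using monic_zeroD[OF assms(1,3)] monic_zeroD[OF assms(2,4)] Comp_assoc[OF _ assms(3,4)]
      Comp_in_Hom[OF _ assms(3)] by simp
qed

lemma epic_Comp:
  assumes "epic C m" "epic C n" "m \<in> Hom C X Y" "n \<in> Hom C Y Z"
  shows "epic C (n \<odot> m)"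
  using preadditive_category.monic_Comp[OF preadditive_category_opposite[OF preadditive_category_axioms],
      of n m Z Y X] assms by simp

lemma epic_CompD:
  assumes "epic C (g \<odot> f)" "f \<in> Hom C X Y" "g \<in> Hom C Y Z"
  shows "epic C g"
proof (rule epicI[OF assms(3)])
  fix V h assume h: "h \<in> Hom C Z V" "h \<odot> g = ZeroArr C Y V"
  then have "h \<odot> (g \<odot> f) = ZeroArr C X V"
    using Comp_assoc[OF assms(2,3) h(1)] zero_Comp[OF assms(2)] Hom_objs[OF h(1)] by simp
  then show "h = ZeroArr C Z V"
    using epic_zeroD[OF assms(1) Comp_in_Hom[OF assms(2,3)] h(1)] by blast
qed

lemma kernel_monic:
  assumes "is_kernel C f k" shows "monic C k"
proof -
  have f: "f \<in> Hom C (Dom C f) (Cod C f)"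
    using assms by (simp add: is_kernel_def Hom_def)
  note k = kernel_in_Hom[OF assms f]
  have "u = v" if "u \<in> Hom C Z (Dom C k)" "v \<in> Hom C Z (Dom C k)" "k \<odot> u = k \<odot> v" for Z u v
  proof -
    have ku: "k \<odot> u \<in> Hom C Z (Dom C f)" by (rule Comp_in_Hom[OF that(1) k])
    have "f \<odot> (k \<odot> u) = ZeroArr C Z (Cod C f)"
      using Comp_assoc[OF that(1) k f] kernel_zero[OF assms f] zero_Comp[OF that(1)] Hom_objs[OF f]
      by simp
    with ku have "\<exists>!w. w \<in> Hom C Z (Dom C k) \<and> k \<odot> w = k \<odot> u"
      using assms unfolding is_kernel_def by blast
    then obtain w where "\<And>y. y \<in> Hom C Z (Dom C k) \<Longrightarrow> k \<odot> y = k \<odot> u \<Longrightarrow> y = w"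
      by (elim ex1E) blast
    from this[OF that(1)] this[OF that(2)] show ?thesis using that(3) by simp
  qed
  then show ?thesis using Hom_sel(1)[OF k] unfolding monic_def by blast
qed

lemma cokernel_epic: "is_cokernel C f c \<Longrightarrow> epic C c"
  using preadditive_category.kernel_monic[OF preadditive_category_opposite[OF preadditive_category_axioms],
      of f c] by simp

text \<open>Two kernels of one arrow factor through each other, and both composites are identities
  because kernels are monic. This moves membership in \<open>S\<close> from a constructed kernel to
  an arbitrary one, as the definition of \<open>W_L\<close> demands.\<close>

lemma kernel_Dom_iso:
  assumes "is_kernel C f k" "is_kernel C f l" "subcategory C S" "Dom C k \<in> S"
  shows "Dom C l \<in> S"
proof -
  have f: "f \<in> Hom C (Dom C f) (Cod C f)"
    using assms by (simp add: is_kernel_def Hom_def)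
  note k = kernel_in_Hom[OF assms(1) f] and l = kernel_in_Hom[OF assms(2) f]
  obtain u where u: "u \<in> Hom C (Dom C l) (Dom C k)" "k \<odot> u = l"
    using kernel_factor[OF assms(1) f l kernel_zero[OF assms(2) f]] by blast
  obtain v where v: "v \<in> Hom C (Dom C k) (Dom C l)" "l \<odot> v = k"
    using kernel_factor[OF assms(2) f k kernel_zero[OF assms(1) f]] by blast
  have "u \<odot> v = Ident C (Dom C k)"
  proof (rule monicD[OF kernel_monic[OF assms(1)] k])
    show "u \<odot> v \<in> Hom C (Dom C k) (Dom C k)" by (rule Comp_in_Hom[OF v(1) u(1)])
    show "Ident C (Dom C k) \<in> Hom C (Dom C k) (Dom C k)" by (rule Ident_in_Hom[OF Hom_objs(1)[OF k]])
    show "k \<odot> (u \<odot> v) = k \<odot> Ident C (Dom C k)"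
      unfolding Comp_assoc[OF v(1) u(1) k, symmetric] u(2) v(2) Comp_Ident[OF k] ..
  qed
  moreover have "v \<odot> u = Ident C (Dom C l)"
  proof (rule monicD[OF kernel_monic[OF assms(2)] l])
    show "v \<odot> u \<in> Hom C (Dom C l) (Dom C l)" by (rule Comp_in_Hom[OF u(1) v(1)])
    show "Ident C (Dom C l) \<in> Hom C (Dom C l) (Dom C l)" by (rule Ident_in_Hom[OF Hom_objs(1)[OF l]])
    show "l \<odot> (v \<odot> u) = l \<odot> Ident C (Dom C l)"
      unfolding Comp_assoc[OF u(1) v(1) l, symmetric] v(2) u(2) Comp_Ident[OF l] ..
  qed
  ultimately have "isomorphism C v"
    using u v by (auto simp: isomorphism_def Hom_sel)
  then show ?thesis
    using assms(3,4) v(1) by (auto simp: subcategory_def Hom_sel)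
qed

text \<open>Base change keeps the kernel object: \<open>k\<close> and the zero arrow into
  \<open>Dom C g\<close> form a compatible pair, and the arrow they induce is a kernel of
  \<open>q\<close>. In an abelian category with \<open>q\<close> epic, this exhibits the apex as an
  extension of \<open>Dom C g\<close> by \<open>Dom C k\<close>, which is how apexes are shown to
  lie in torsion classes.\<close>

lemma pullback_kernel:
  assumes "is_pullback C f g p q" "is_kernel C f k"
  obtains k' where "is_kernel C q k'" "Dom C k' = Dom C k" "p \<odot> k' = k"
proof -
  have f: "f \<in> Hom C (Dom C f) (Cod C g)" and g: "g \<in> Hom C (Dom C g) (Cod C g)"
    and p: "p \<in> Hom C (Dom C q) (Dom C f)" and q: "q \<in> Hom C (Dom C q) (Dom C g)"
    and pq: "f \<odot> p = g \<odot> q"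
    and univ: "\<And>Z x y. x \<in> Hom C Z (Dom C f) \<Longrightarrow> y \<in> Hom C Z (Dom C g) \<Longrightarrow> f \<odot> x = g \<odot> y \<Longrightarrow>
      \<exists>!u. u \<in> Hom C Z (Dom C q) \<and> p \<odot> u = x \<and> q \<odot> u = y"
    using assms(1) by (auto simp: is_pullback_def)
  note k = kernel_in_Hom[OF assms(2) f]
  let ?K = "Dom C k"
  note obj = Hom_objs[OF f] Hom_objs[OF q] Hom_objs[OF k]
  have "f \<odot> k = g \<odot> ZeroArr C ?K (Dom C g)"
    using kernel_zero[OF assms(2) f] Comp_zero[OF g] obj by simp
  then obtain k' where k': "k' \<in> Hom C ?K (Dom C q)" "p \<odot> k' = k" "q \<odot> k' = ZeroArr C ?K (Dom C g)"
    using univ[OF k zero_in_Hom] obj by blast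
  have "is_kernel C q k'"
  proof (rule is_kernelI[OF q k'(1) _ k'(3)])
    have "h = ZeroArr C Z ?K" if "h \<in> Hom C Z ?K" "k' \<odot> h = ZeroArr C Z (Dom C q)" for Z h
    proof (rule monic_zeroD[OF kernel_monic[OF assms(2)] k that(1)])
      show "k \<odot> h = ZeroArr C Z (Dom C f)"
        using Comp_assoc[OF that(1) k'(1) p] that(2) k'(2) Comp_zero[OF p] Hom_objs[OF that(1)] by simp
    qed
    then show "monic C k'" by (rule monicI[OF k'(1)])
  next
    fix Z h assume h: "h \<in> Hom C Z (Dom C q)" "q \<odot> h = ZeroArr C Z (Dom C g)"
    have ph: "p \<odot> h \<in> Hom C Z (Dom C f)" using Comp_in_Hom h p by blast
    have "f \<odot> (p \<odot> h) = ZeroArr C Z (Cod C g)"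
      using Comp_assoc[OF h(1) p f] Comp_assoc[OF h(1) q g] pq h(2) Comp_zero[OF g]
        Hom_objs[OF h(1)] by simp
    then obtain u where u: "u \<in> Hom C Z ?K" "k \<odot> u = p \<odot> h"
      using kernel_factor[OF assms(2) f ph] by blast
    \<comment> \<open>Both sides have the same composites with \<open>p\<close> and with
      \<open>q\<close>, so uniqueness in the pullback property identifies them.\<close>
    have "k' \<odot> u = h"
    proof -
      have "p \<odot> (k' \<odot> u) = p \<odot> h" using u(2) k'(2) Comp_assoc[OF u(1) k'(1) p] by simp
      moreover have "q \<odot> (k' \<odot> u) = q \<odot> h"
        using Comp_assoc[OF u(1) k'(1) q] k'(3) zero_Comp[OF u(1)] h(2) obj by simp
      moreover have "k' \<odot> u \<in> Hom C Z (Dom C q)" using u k' Comp_in_Hom by blast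
      moreover have "f \<odot> (p \<odot> h) = g \<odot> (q \<odot> h)"
        using Comp_assoc[OF h(1) p f] Comp_assoc[OF h(1) q g] pq by simp
      moreover have "q \<odot> h \<in> Hom C Z (Dom C g)" using Comp_in_Hom h q by blast
      ultimately show ?thesis using univ[OF ph, of "q \<odot> h"] h(1) by metis
    qed
    then show "\<exists>u \<in> Hom C Z ?K. k' \<odot> u = h" using u by blast
  qed
  then show thesis using that k' Hom_sel(2)[OF k'(1)] by blast
qed

text \<open>An arrow \<open>x\<close> is killed by \<open>h \<odot> f\<close> exactly when
  \<open>f \<odot> x\<close> factors through the kernel \<open>l\<close> of \<open>h\<close>, so the
  preimage of \<open>l\<close> under \<open>f\<close> is the kernel of the composite.\<close>

lemma pullback_kernel_Comp:
  assumes "is_pullback C f l p q" "is_kernel C h l" "h \<in> Hom C (Cod C l) V"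
  shows "is_kernel C (h \<odot> f) p"
proof -
  have f: "f \<in> Hom C (Dom C f) (Cod C l)" and l: "l \<in> Hom C (Dom C l) (Cod C l)"
    and p: "p \<in> Hom C (Dom C q) (Dom C f)" and q: "q \<in> Hom C (Dom C q) (Dom C l)"
    and pq: "f \<odot> p = l \<odot> q"
    and univ: "\<And>Z x y. x \<in> Hom C Z (Dom C f) \<Longrightarrow> y \<in> Hom C Z (Dom C l) \<Longrightarrow> f \<odot> x = l \<odot> y \<Longrightarrow>
      \<exists>!u. u \<in> Hom C Z (Dom C q) \<and> p \<odot> u = x \<and> q \<odot> u = y"
    using assms(1) by (auto simp: is_pullback_def)
  note h = assms(3)
  have hf: "h \<odot> f \<in> Hom C (Dom C f) V" using Comp_in_Hom f h by blast
  show ?thesis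
  proof (rule is_kernelI[OF hf p])
    have "u = v" if uv: "u \<in> Hom C Z (Dom C q)" "v \<in> Hom C Z (Dom C q)" "p \<odot> u = p \<odot> v" for Z u v
    proof -
      have qu: "q \<odot> u \<in> Hom C Z (Dom C l)" and qv: "q \<odot> v \<in> Hom C Z (Dom C l)"
        and pv: "p \<odot> v \<in> Hom C Z (Dom C f)"
        using Comp_in_Hom uv p q by blast+
      have "l \<odot> (q \<odot> u) = l \<odot> (q \<odot> v)"
        using Comp_assoc[OF uv(1) q l] Comp_assoc[OF uv(2) q l] Comp_assoc[OF uv(1) p f]
          Comp_assoc[OF uv(2) p f] pq uv(3) by simp
      then have "q \<odot> u = q \<odot> v" using monicD[OF kernel_monic[OF assms(2)] l qu qv] by blast
      moreover have "f \<odot> (p \<odot> v) = l \<odot> (q \<odot> v)"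
        using Comp_assoc[OF uv(2) q l] Comp_assoc[OF uv(2) p f] pq by simp
      ultimately show "u = v" using univ[OF pv qv] uv by metis
    qed
    then show "monic C p" unfolding monic_def Hom_sel(2)[OF p] using Hom_sel(1)[OF p] by blast
    show "(h \<odot> f) \<odot> p = ZeroArr C (Dom C q) V"
      using Comp_assoc[OF p f h] Comp_assoc[OF q l h] pq kernel_zero[OF assms(2) h]
        zero_Comp[OF q] Hom_objs[OF h] by simp
  next
    fix Z x assume x: "x \<in> Hom C Z (Dom C f)" "(h \<odot> f) \<odot> x = ZeroArr C Z V"
    have fx: "f \<odot> x \<in> Hom C Z (Cod C l)" using Comp_in_Hom x f by blast
    have "h \<odot> (f \<odot> x) = ZeroArr C Z V" using Comp_assoc[OF x(1) f h] x(2) by simp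
    then obtain y where "y \<in> Hom C Z (Dom C l)" "l \<odot> y = f \<odot> x"
      using kernel_factor[OF assms(2) h fx] by blast
    then show "\<exists>u \<in> Hom C Z (Dom C q). p \<odot> u = x" using univ[OF x(1)] by metis
  qed
qed

lemma Ident_zeroD:
  assumes "Ident C X = ZeroArr C X X" "f \<in> Hom C X Y"
  shows "f = ZeroArr C X Y"
  using Comp_Ident[OF assms(2)] Comp_zero[OF assms(2)] Hom_objs[OF assms(2)] assms(1) by simp

lemma Ident_zeroD':
  assumes "Ident C X = ZeroArr C X X" "f \<in> Hom C Y X"
  shows "f = ZeroArr C Y X"
  using Ident_Comp[OF assms(2)] zero_Comp[OF assms(2)] Hom_objs[OF assms(2)] assms(1) by simp

lemma zero_object_Ident: "zero_object C Z \<Longrightarrow> Ident C Z = ZeroArr C Z Z"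
  using Ident_in_Hom[of Z] zero_in_Hom[of Z Z] unfolding zero_object_def by blast

end

section \<open>Abelian categories: images and pullbacks of epimorphisms\<close>

context abelian_category
begin

text \<open>By normality \<open>e\<close> is the cokernel of some \<open>f\<close>. This
  \<open>f\<close> factors through \<open>k\<close>, so every arrow that kills \<open>k\<close>
  kills \<open>f\<close> and hence factors through \<open>e\<close>.\<close>

lemma epic_is_cokernel:
  assumes "epic C e" "is_kernel C e k"
  shows "is_cokernel C k e"
proof -
  note e = epic_in_Hom[OF assms(1)]
  note k = kernel_in_Hom[OF assms(2) e]
  obtain f where f: "is_cokernel C f e" using epic_normal assms(1) by blast
  then have fH: "f \<in> Hom C (Dom C f) (Dom C e)" by (simp add: is_cokernel_def Hom_def)
  obtain u where u: "u \<in> Hom C (Dom C f) (Dom C k)" "k \<odot> u = f"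
    using kernel_factor[OF assms(2) e fH cokernel_zero[OF f fH]] by blast
  \<comment> \<open>The cokernel property is checked as a kernel property in the opposite category,
    so that \<open>is_kernelI\<close> applies.\<close>
  have "is_kernel (opposite C) k e"
  proof (rule is_kernelI)
    fix Z h assume "h \<in> Hom (opposite C) Z (Dom C e)" "k \<odot>\<^bsub>opposite C\<^esub> h = ZeroArr (opposite C) Z (Dom C k)"
    then have h: "h \<in> Hom C (Dom C e) Z" "h \<odot> k = ZeroArr C (Dom C k) Z" by simp_all
    have "h \<odot> f = ZeroArr C (Dom C f) Z"
      using Comp_assoc[OF u(1) k h(1)] u h zero_Comp Hom_objs by metis
    then obtain v where "v \<in> Hom C (Cod C e) Z" "v \<odot> e = h"
      using cokernel_factor[OF f fH h(1)] by blast
    then show "\<exists>u \<in> Hom (opposite C) Z (Cod C e). e \<odot>\<^bsub>opposite C\<^esub> u = h" by auto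
  qed (use e k assms(1) kernel_zero[OF assms(2) e] in simp_all)
  then show ?thesis by simp
qed

lemma epic_short_exact: "epic C e \<Longrightarrow> is_kernel C e k \<Longrightarrow> short_exact C k e"
  by (simp add: short_exact_def epic_is_cokernel)

lemma monic_is_kernel: "monic C m \<Longrightarrow> is_cokernel C m c \<Longrightarrow> is_kernel C c m"
  using abelian_category.epic_is_cokernel[OF abelian_category_opposite[OF abelian_category_axioms],
      of m c] by simp

text \<open>The image \<open>m\<close> is the kernel of the cokernel. If \<open>t\<close> kills
  \<open>e\<close>, then \<open>f\<close> already factors through the smaller subobject
  \<open>m \<odot> k\<close>, where \<open>k\<close> is the kernel of \<open>t\<close>; by normality
  that subobject cannot be proper, so \<open>t\<close> is zero.\<close>

lemma image_factorization:
  assumes f: "f \<in> Hom C X Y" and c: "is_cokernel C f c"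
  obtains m e where "is_kernel C c m" "epic C e" "e \<in> Hom C X (Dom C m)" "m \<in> Hom C (Dom C m) Y"
    "m \<odot> e = f"
proof -
  note cH = cokernel_in_Hom[OF c f]
  obtain m where m: "is_kernel C c m" using ex_kernel Hom_sel(1)[OF cH] by blast
  note mH = kernel_in_Hom[OF m cH]
  let ?I = "Dom C m"
  obtain e where e: "e \<in> Hom C X ?I" "m \<odot> e = f"
    using kernel_factor[OF m cH f cokernel_zero[OF c f]] by blast
  have "epic C e"
  proof (rule epicI[OF e(1)])
    fix Z t assume t: "t \<in> Hom C ?I Z" "t \<odot> e = ZeroArr C X Z"
    obtain k where k: "is_kernel C t k" using ex_kernel Hom_sel(1)[OF t(1)] by blast
    note kH = kernel_in_Hom[OF k t(1)]
    obtain e' where e': "e' \<in> Hom C X (Dom C k)" "k \<odot> e' = e"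
      using kernel_factor[OF k t(1) e(1) t(2)] by blast
    have mkH: "m \<odot> k \<in> Hom C (Dom C k) Y" using Comp_in_Hom kH mH by blast
    have "monic C (m \<odot> k)" using monic_Comp kernel_monic k m kH mH by blast
    then obtain w where w: "is_kernel C w (m \<odot> k)" using monic_normal by blast
    define V where "V = Cod C w"
    have wH: "w \<in> Hom C Y V"
      using w mkH by (auto simp: is_kernel_def Hom_def V_def)
    have w0: "w \<odot> (m \<odot> k) = ZeroArr C (Dom C k) V"
      using kernel_zero[OF w wH] Hom_sel(2)[OF mkH] by simp
    have "w \<odot> f = (w \<odot> (m \<odot> k)) \<odot> e'"
      using Comp_assoc[OF e'(1) mkH wH] Comp_assoc[OF e'(1) kH mH] e e' by simp
    also have "\<dots> = ZeroArr C X V" using w0 zero_Comp[OF e'(1)] Hom_objs[OF wH] by simp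
    finally obtain w' where w': "w' \<in> Hom C (Cod C c) V" "w' \<odot> c = w"
      using cokernel_factor[OF c f wH] by blast
    have "w \<odot> m = ZeroArr C ?I V"
      using Comp_assoc[OF mH cH w'(1)] w'(2) kernel_zero[OF m cH] Comp_zero[OF w'(1)] Hom_objs[OF mH]
      by simp
    \<comment> \<open>\<open>w\<close> kills \<open>f\<close>, hence factors through
      \<open>c\<close>, hence kills \<open>m\<close>; since \<open>m \<odot> k\<close> is a kernel
      of \<open>w\<close>, the arrow \<open>m\<close> factors through it, and \<open>k\<close>
      acquires the right inverse \<open>v\<close>.\<close>
    then obtain v where v: "v \<in> Hom C ?I (Dom C k)" "(m \<odot> k) \<odot> v = m"
      using kernel_factor[OF w wH mH] Hom_sel(2)[OF mkH] by metis
    have "m \<odot> (k \<odot> v) = m \<odot> Ident C ?I"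
      using Comp_assoc[OF v(1) kH mH] v(2) Comp_Ident[OF mH] by simp
    then have kv: "k \<odot> v = Ident C ?I"
      using monicD[OF kernel_monic[OF m] mH] Comp_in_Hom[OF v(1) kH] Ident_in_Hom Hom_objs[OF mH]
      by blast
    have "t = t \<odot> (k \<odot> v)" using kv Comp_Ident[OF t(1)] by simp
    also have "\<dots> = ZeroArr C ?I Z"
      using Comp_assoc[OF v(1) kH t(1)] kernel_zero[OF k t(1)] zero_Comp[OF v(1)] Hom_objs[OF t(1)]
      by simp
    finally show "t = ZeroArr C ?I Z" .
  qed
  then show thesis using that m e mH by blast
qed

text \<open>The pullback is the kernel of a difference arrow \<open>d\<close> from the biproduct of
  \<open>Y\<close> and \<open>Z\<close> to \<open>V\<close>. As \<open>c\<close> is epic, so is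
  \<open>d\<close>; then \<open>d\<close> is the cokernel of its kernel, which forces
  \<open>q\<close> to be epic.\<close>

lemma ex_pullback_of_epic:
  assumes c: "c \<in> Hom C Y V" and g: "g \<in> Hom C Z V" and ep: "epic C c"
  obtains p q where "is_pullback C c g p q" "epic C q"
proof -
  note obj = Hom_objs[OF c] Hom_objs[OF g]
  obtain B i j r s where "biproduct C Y Z B i j r s" using ex_biproduct obj by blast
  then have i: "i \<in> Hom C Y B" and j: "j \<in> Hom C Z B" and r: "r \<in> Hom C B Y" and s: "s \<in> Hom C B Z"
    and ri: "r \<odot> i = Ident C Y" and sj: "s \<odot> j = Ident C Z"
    and rj: "r \<odot> j = ZeroArr C Z Y" and si: "s \<odot> i = ZeroArr C Y Z"
    and irjs: "(i \<odot> r) \<boxplus> (j \<odot> s) = Ident C B"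
    by (auto simp: biproduct_def)
  \<comment> \<open>\<open>n\<close> is the negative of \<open>g\<close>, so \<open>d\<close> below
    restricts to \<open>c\<close> on \<open>Y\<close> and to minus \<open>g\<close> on
    \<open>Z\<close>.\<close>
  obtain n where n: "n \<in> Hom C Z V" "g \<boxplus> n = ZeroArr C Z V" using ex_neg g by blast
  define d where "d = (c \<odot> r) \<boxplus> (n \<odot> s)"
  have cr: "c \<odot> r \<in> Hom C B V" and ns: "n \<odot> s \<in> Hom C B V" using Comp_in_Hom c r n s by blast+
  then have d: "d \<in> Hom C B V" by (simp add: d_def add_in_Hom)
  have di: "d \<odot> i = c"
    using Comp_Add[OF i cr ns] Comp_assoc[OF i r c] Comp_assoc[OF i s n(1)] ri si
    by (simp add: d_def Comp_Ident[OF c] Comp_zero[OF n(1)] obj add_zero[OF c])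
  have dj: "d \<odot> j = n"
    using Comp_Add[OF j cr ns] Comp_assoc[OF j r c] Comp_assoc[OF j s n(1)] rj sj
    by (simp add: d_def Comp_Ident[OF n(1)] Comp_zero[OF c] obj zero_add[OF n(1)])
  obtain k where k: "is_kernel C d k" using ex_kernel Hom_sel(1)[OF d] by blast
  note kH = kernel_in_Hom[OF k d]
  define P where "P = Dom C k"
  have kH: "k \<in> Hom C P B" using kH by (simp add: P_def)
  define p where "p = r \<odot> k"
  define q where "q = s \<odot> k"
  have p: "p \<in> Hom C P Y" and q: "q \<in> Hom C P Z"
    unfolding p_def q_def using Comp_in_Hom kH r s by blast+
  have epd: "epic C d" using epic_CompD[of d i] di ep i d by simp
  have nq: "n \<odot> q \<in> Hom C P V" using Comp_in_Hom q n by blast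
  have "(c \<odot> p) \<boxplus> (n \<odot> q) = d \<odot> k"
    using Comp_Add[OF kH cr ns] Comp_assoc[OF kH r c] Comp_assoc[OF kH s n(1)]
    by (simp add: d_def p_def q_def)
  also have "\<dots> = ZeroArr C P V" using kernel_zero[OF k d] by (simp add: P_def)
  also have "\<dots> = (g \<odot> q) \<boxplus> (n \<odot> q)"
    using Comp_Add[OF q g n(1)] n(2) zero_Comp[OF q] obj by simp
  finally have cp: "c \<odot> p = g \<odot> q"
    using add_right_cancel nq Comp_in_Hom[OF p c] Comp_in_Hom[OF q g] by blast
  \<comment> \<open>The projections \<open>r\<close> and \<open>s\<close> are jointly monic, since
    an arrow into the biproduct is rebuilt from its components.\<close>
  have joint: "u = v" if uv: "u \<in> Hom C X B" "v \<in> Hom C X B" "r \<odot> u = r \<odot> v" "s \<odot> u = s \<odot> v" for X u v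
  proof -
    have "w = (i \<odot> (r \<odot> w)) \<boxplus> (j \<odot> (s \<odot> w))" if w: "w \<in> Hom C X B" for w
      using Comp_Add[OF w Comp_in_Hom[OF r i] Comp_in_Hom[OF s j]] Comp_assoc[OF w r i]
        Comp_assoc[OF w s j] irjs Ident_Comp[OF w] by simp
    then show ?thesis using uv by metis
  qed
  have "is_pullback C c g p q"
    unfolding is_pullback_def Hom_sel(2)[OF c] Hom_sel(2)[OF g] Hom_sel(3)[OF g] Hom_sel(2)[OF q]
  proof (intro conjI allI ballI impI ex_ex1I)
    fix X x y assume x: "x \<in> Hom C X Y" and y: "y \<in> Hom C X Z" and xy: "c \<odot> x = g \<odot> y"
    define u where "u = (i \<odot> x) \<boxplus> (j \<odot> y)"
    have ix: "i \<odot> x \<in> Hom C X B" and jy: "j \<odot> y \<in> Hom C X B" using Comp_in_Hom x y i j by blast+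
    then have u: "u \<in> Hom C X B" by (simp add: u_def add_in_Hom)
    have "d \<odot> u = (c \<odot> x) \<boxplus> (n \<odot> y)"
      using Add_Comp[OF ix jy d] Comp_assoc[OF x i d] Comp_assoc[OF y j d] di dj by (simp add: u_def)
    also have "\<dots> = ZeroArr C X V"
      using xy Comp_Add[OF y g n(1)] n(2) zero_Comp[OF y] obj by simp
    finally obtain w where w: "w \<in> Hom C X P" "k \<odot> w = u"
      using kernel_factor[OF k d u] P_def by blast
    have "r \<odot> u = x"
      unfolding u_def Add_Comp[OF ix jy r] Comp_assoc[OF x i r, symmetric]
        Comp_assoc[OF y j r, symmetric] ri rj Ident_Comp[OF x] zero_Comp[OF y obj(1)]
      by (rule add_zero[OF x])
    moreover have "s \<odot> u = y"
      unfolding u_def Add_Comp[OF ix jy s] Comp_assoc[OF x i s, symmetric]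
        Comp_assoc[OF y j s, symmetric] sj si Ident_Comp[OF y] zero_Comp[OF x obj(3)]
      by (rule zero_add[OF y])
    ultimately show "\<exists>w. w \<in> Hom C X P \<and> p \<odot> w = x \<and> q \<odot> w = y"
      using w Comp_assoc[OF w(1) kH r] Comp_assoc[OF w(1) kH s] by (auto simp: p_def q_def)
  next
    fix X x y u v
    assume u: "u \<in> Hom C X P \<and> p \<odot> u = x \<and> q \<odot> u = y" and v: "v \<in> Hom C X P \<and> p \<odot> v = x \<and> q \<odot> v = y"
    have "k \<odot> u = k \<odot> v"
      by (rule joint[where X = X]) (use u v kH r s in \<open>auto simp: Comp_in_Hom Comp_assoc[symmetric] p_def q_def\<close>)
    then show "u = v" using monicD[OF kernel_monic[OF k] kH] u v by blast
  qed (fact c g p q cp)+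
  moreover have "epic C q"
  proof (rule epicI[OF q])
    fix X h assume h: "h \<in> Hom C Z X" "h \<odot> q = ZeroArr C P X"
    have hs: "h \<odot> s \<in> Hom C B X" using Comp_in_Hom h s by blast
    have "(h \<odot> s) \<odot> k = ZeroArr C P X" using Comp_assoc[OF kH s h(1)] h(2) by (simp add: q_def)
    \<comment> \<open>\<open>h \<odot> s\<close> kills the kernel of \<open>d\<close>, so it
      descends along \<open>d\<close> to \<open>u\<close>. Restricting to \<open>Y\<close>, where
      \<open>s\<close> vanishes, shows that \<open>u \<odot> c\<close> is zero; hence
      \<open>u\<close> is zero, and restricting to \<open>Z\<close> gives the same for
      \<open>h\<close>.\<close>
    then obtain u where u: "u \<in> Hom C V X" "u \<odot> d = h \<odot> s"
      using cokernel_factor[OF epic_is_cokernel[OF epd k] kH hs] Hom_sel(3)[OF d] by metis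
    have "u \<odot> c = (h \<odot> s) \<odot> i" using Comp_assoc[OF i d u(1)] di u(2) by simp
    also have "\<dots> = ZeroArr C Y X"
      using Comp_assoc[OF i s h(1)] si Comp_zero[OF h(1)] obj by simp
    finally have "u = ZeroArr C V X" using epic_zeroD[OF ep c u(1)] by blast
    then have hs0: "h \<odot> s = ZeroArr C B X" using u zero_Comp[OF d] Hom_objs[OF h(1)] by simp
    have "h = (h \<odot> s) \<odot> j" using Comp_assoc[OF j s h(1)] sj Comp_Ident[OF h(1)] by simp
    then show "h = ZeroArr C Z X" using hs0 zero_Comp[OF j] Hom_objs[OF h(1)] by simp
  qed
  ultimately show thesis using that by blast
qed

end

section \<open>Torsion sequences\<close>

lemma torsD:
  assumes "T \<in> tors C"
  shows "subcategory C T" "closed_under_extensions C T" "closed_under_factors C T"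
  using assms by (simp_all add: tors_def)

lemma tors_factor: "T \<in> tors C \<Longrightarrow> epic C e \<Longrightarrow> e \<in> Hom C X Y \<Longrightarrow> X \<in> T \<Longrightarrow> Y \<in> T"
  by (auto dest!: torsD(3) simp: closed_under_factors_def Hom_def)

lemma (in abelian_category) tors_extension:
  assumes "T \<in> tors C" "epic C e" "is_kernel C e k" "Dom C k \<in> T" "e \<in> Hom C X Y" "Y \<in> T"
  shows "X \<in> T"
proof -
  have "short_exact C k e" by (rule epic_short_exact[OF assms(2,3)])
  then have "Cod C k \<in> T"
    using torsD(2)[OF assms(1)] assms(4,6) Hom_sel(3)[OF assms(5)]
    unfolding closed_under_extensions_def by blast
  then show ?thesis using kernel_in_Hom[OF assms(3,5)] by (simp add: Hom_def)
qed

text \<open>This is the canonical sequence of the torsion pair given by \<open>U\<close>: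
  \<open>Dom C a\<close> is the torsion part of \<open>X\<close> and \<open>Cod C b\<close> its
  torsion-free quotient. The condition on \<open>b\<close> fixes \<open>X\<close> as the middle
  term.\<close>

definition has_torsion_sequence :: "('o, 'a, 'm) preadditive_scheme \<Rightarrow> 'o set \<Rightarrow> 'o \<Rightarrow> bool" where
  "has_torsion_sequence C U X \<longleftrightarrow>
    (\<exists>a b. short_exact C a b \<and> Dom C a \<in> U \<and> b \<in> Hom C X (Cod C b) \<and> Cod C b \<in> right_perp C U)"

lemma right_perpD:
  "Y \<in> right_perp C S \<Longrightarrow> X \<in> S \<Longrightarrow> f \<in> Hom C X Y \<Longrightarrow> f = ZeroArr C X Y"
  by (auto simp: right_perp_def)

lemma (in preadditive_category) right_perpI:
  assumes "Y \<in> Obj C" "S \<subseteq> Obj C"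
    and "\<And>X f. X \<in> S \<Longrightarrow> f \<in> Hom C X Y \<Longrightarrow> f = ZeroArr C X Y"
  shows "Y \<in> right_perp C S"
  using assms zero_in_Hom unfolding right_perp_def by blast

text \<open>An arrow into a subobject is zero once its composite with the inclusion is; an arrow
  into an extension that dies in the quotient factors through the subobject. So a right
  perpendicular is a torsion-free class, and that is a torsion class of the opposite
  category.\<close>

lemma (in additive_category) right_perp_tors_opposite:
  assumes "S \<subseteq> Obj C"
  shows "right_perp C S \<in> tors (opposite C)"
proof -
  let ?F = "right_perp C S"
  have sub: "X \<in> ?F" if m: "monic C m" "m \<in> Hom C X Y" and Y: "Y \<in> ?F" for m X Y
  proof (rule right_perpI[OF Hom_objs(1)[OF m(2)] assms])
    fix Z f assume "Z \<in> S" "f \<in> Hom C Z X"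
    then show "f = ZeroArr C Z X"
      using monic_zeroD[OF m] right_perpD[OF Y] Comp_in_Hom[OF _ m(2)] by simp
  qed
  have ext: "E \<in> ?F" if se: "short_exact C f g" and f: "f \<in> Hom C A E" and g: "g \<in> Hom C E B"
    and A: "A \<in> ?F" and B: "B \<in> ?F" for f g A E B
  proof (rule right_perpI[OF Hom_objs(1)[OF g] assms])
    fix Z x assume Z: "Z \<in> S" and x: "x \<in> Hom C Z E"
    have k: "is_kernel C g f" using se by (simp add: short_exact_def)
    have "g \<odot> x = ZeroArr C Z B" by (rule right_perpD[OF B Z Comp_in_Hom[OF x g]])
    then obtain y where y: "y \<in> Hom C Z A" "f \<odot> y = x"
      using kernel_factor[OF k g x] Hom_sel(2)[OF f] by metis
    then show "x = ZeroArr C Z E"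
      using right_perpD[OF A Z y(1)] Comp_zero[OF f] Hom_objs[OF x] by simp
  qed
  obtain Z0 where Z0: "zero_object C Z0" using ex_zero_object by blast
  have "Z0 \<in> ?F"
    by (rule right_perpI[OF _ assms])
      (use Z0 in \<open>simp_all add: zero_object_def[of C Z0] Ident_zeroD'[OF zero_object_Ident[OF Z0]]\<close>)
  moreover have "Cod C f \<in> ?F" if iso: "isomorphism C f" and "Dom C f \<in> ?F" for f
  proof -
    obtain g where g: "g \<in> Hom C (Cod C f) (Dom C f)" "g \<odot> f = Ident C (Dom C f)"
      "f \<odot> g = Ident C (Cod C f)" and f: "f \<in> Hom C (Dom C f) (Cod C f)"
      using iso by (auto simp: isomorphism_def Hom_def)
    \<comment> \<open>The inverse of \<open>f\<close> embeds \<open>Cod C f\<close> into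
      \<open>Dom C f\<close>, so closure under isomorphism is a case of closure under
      subobjects.\<close>
    have "monic C g"
    proof (rule monicI[OF g(1)])
      fix Z h assume h: "h \<in> Hom C Z (Cod C f)" "g \<odot> h = ZeroArr C Z (Dom C f)"
      show "h = ZeroArr C Z (Cod C f)"
        using Comp_assoc[OF h(1) g(1) f] h(2) g(3) Ident_Comp[OF h(1)] Comp_zero[OF f] Hom_objs[OF h(1)]
        by simp
    qed
    then show ?thesis using sub g(1) that(2) by blast
  qed
  moreover have "?F \<subseteq> Obj C" by (auto simp: right_perp_def)
  ultimately have "subcategory C ?F" by (auto simp: subcategory_def)
  moreover have "closed_under_extensions C ?F"
    unfolding closed_under_extensions_def
  proof (intro allI impI, elim conjE)
    fix f g assume se: "short_exact C f g" and fg: "Dom C f \<in> ?F" "Cod C g \<in> ?F"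
    then have "f \<in> Hom C (Dom C f) (Cod C f)" "g \<in> Hom C (Cod C f) (Cod C g)"
      by (auto simp: short_exact_def is_kernel_def Hom_def)
    then show "Cod C f \<in> ?F" using ext[OF se] fg by blast
  qed
  moreover have "closed_under_subobjects C ?F"
    unfolding closed_under_subobjects_def using sub[OF _ monic_in_Hom] by blast
  ultimately show ?thesis by (simp add: tors_def)
qed

section \<open>Existence of torsion sequences by induction along a composition series\<close>

context abelian_category
begin

text \<open>The preimage in \<open>X\<close> of the torsion part of \<open>Y\<close> is an extension
  of that part by the kernel of \<open>q\<close>, so it lies in \<open>U\<close>; the torsion-free
  quotient does not change.\<close>

lemma has_torsion_sequence_lift:
  assumes U: "U \<in> tors C" and q: "epic C q" "q \<in> Hom C X Y" and n: "is_kernel C q n" "Dom C n \<in> U"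
    and Y: "has_torsion_sequence C U Y"
  shows "has_torsion_sequence C U X"
proof -
  obtain a b where ab: "short_exact C a b" "Dom C a \<in> U" "b \<in> Hom C Y (Cod C b)"
    "Cod C b \<in> right_perp C U"
    using Y by (auto simp: has_torsion_sequence_def)
  have ka: "is_kernel C b a" and epb: "epic C b"
    using ab(1) cokernel_epic by (auto simp: short_exact_def)
  note a = kernel_in_Hom[OF ka ab(3)]
  obtain p r where pb: "is_pullback C q a p r" and r: "epic C r"
    using ex_pullback_of_epic[OF q(2) a q(1)] by blast
  have rH: "r \<in> Hom C (Dom C r) (Dom C a)" and pH: "p \<in> Hom C (Dom C r) X"
    using pb Hom_sel(2)[OF q(2)] by (auto simp: is_pullback_def)
  obtain k where k: "is_kernel C r k" "Dom C k = Dom C n"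
    using pullback_kernel[OF pb n(1)] by blast
  have PU: "Dom C r \<in> U" by (rule tors_extension[OF U r k(1) _ rH ab(2)]) (simp add: k(2) n(2))
  have bq: "b \<odot> q \<in> Hom C X (Cod C b)" by (rule Comp_in_Hom[OF q(2) ab(3)])
  have ker: "is_kernel C (b \<odot> q) p"
    by (rule pullback_kernel_Comp[OF pb ka]) (use ab(3) Hom_sel(3)[OF a] in simp)
  have "short_exact C p (b \<odot> q)"
    by (rule epic_short_exact[OF epic_Comp[OF q(1) epb q(2) ab(3)] ker])
  then show ?thesis
    unfolding has_torsion_sequence_def using PU Hom_sel(2)[OF pH] Hom_sel(3)[OF bq] bq ab(4)
    by (intro exI[of _ p] exI[of _ "b \<odot> q"]) simp
qed

text \<open>If some arrow \<open>i\<close> from \<open>U\<close> to \<open>Q\<close> reaches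
  \<open>S\<close> nontrivially, it covers \<open>S\<close>; dividing \<open>Q\<close> by the image
  of \<open>i\<close> leaves a factor object of \<open>X\<close>, and its sequence lifts to
  \<open>Q\<close>. Otherwise all arrows from \<open>U\<close> land in the image of
  \<open>m\<close>, a factor object of \<open>X\<close> whose torsion part then serves for
  \<open>Q\<close>.\<close>

lemma has_torsion_sequence_extension:
  assumes U: "U \<in> tors C" and m: "m \<in> Hom C X Q" and s: "is_cokernel C m s" "s \<in> Hom C Q S"
    and S: "\<And>Z f. f \<in> Hom C Z S \<Longrightarrow> f = ZeroArr C Z S \<or> epic C f"
    and X: "\<And>e. epic C e \<Longrightarrow> Dom C e = X \<Longrightarrow> has_torsion_sequence C U (Cod C e)"
  shows "has_torsion_sequence C U Q"
proof (cases "\<exists>Z \<in> U. \<exists>i \<in> Hom C Z Q. s \<odot> i \<noteq> ZeroArr C Z S")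
  case True
  then obtain Z i where i: "Z \<in> U" "i \<in> Hom C Z Q" "s \<odot> i \<noteq> ZeroArr C Z S" by blast
  have si: "s \<odot> i \<in> Hom C Z S" by (rule Comp_in_Hom[OF i(2) s(2)])
  then have esi: "epic C (s \<odot> i)" using S i(3) by blast
  obtain c where c: "is_cokernel C i c" using ex_cokernel Hom_sel(1)[OF i(2)] by blast
  note cH = cokernel_in_Hom[OF c i(2)]
  obtain n r where n: "is_kernel C c n" and r: "epic C r" "r \<in> Hom C Z (Dom C n)"
    using image_factorization[OF i(2) c] by blast
  have nU: "Dom C n \<in> U" by (rule tors_factor[OF U r i(1)])
  have cm: "c \<odot> m \<in> Hom C X (Cod C c)" by (rule Comp_in_Hom[OF m cH])
  \<comment> \<open>The images of \<open>m\<close> and \<open>i\<close> together exhaust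
    \<open>Q\<close>: if \<open>h \<odot> c\<close> kills \<open>m\<close>, it descends to
    \<open>S\<close>, and there it vanishes because it also kills the epic
    \<open>s \<odot> i\<close>.\<close>
  have "epic C (c \<odot> m)"
  proof (rule epicI[OF cm])
    fix V h assume h: "h \<in> Hom C (Cod C c) V" "h \<odot> (c \<odot> m) = ZeroArr C X V"
    have hc: "h \<odot> c \<in> Hom C Q V" by (rule Comp_in_Hom[OF cH h(1)])
    have "(h \<odot> c) \<odot> m = ZeroArr C X V" using Comp_assoc[OF m cH h(1)] h(2) by simp
    then obtain v where v: "v \<in> Hom C S V" "v \<odot> s = h \<odot> c"
      using cokernel_factor[OF s(1) m hc] Hom_sel(3)[OF s(2)] by metis
    have "v \<odot> (s \<odot> i) = ZeroArr C Z V"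
      using Comp_assoc[OF i(2) s(2) v(1)] Comp_assoc[OF i(2) cH h(1)] v(2) cokernel_zero[OF c i(2)]
        Comp_zero[OF h(1)] Hom_objs[OF i(2)] by simp
    then have "v = ZeroArr C S V" using epic_zeroD[OF esi si v(1)] by blast
    then have "h \<odot> c = ZeroArr C Q V" using v(2) zero_Comp[OF s(2)] Hom_objs[OF h(1)] by simp
    then show "h = ZeroArr C (Cod C c) V" using epic_zeroD[OF cokernel_epic[OF c] cH h(1)] by blast
  qed
  then have "has_torsion_sequence C U (Cod C c)" using X Hom_sel(2,3)[OF cm] by metis
  then show ?thesis by (rule has_torsion_sequence_lift[OF U cokernel_epic[OF c] cH n nU])
next
  case False
  obtain n r where n: "is_kernel C s n" "n \<in> Hom C (Dom C n) Q"
    and r: "epic C r" "r \<in> Hom C X (Dom C n)"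
    using image_factorization[OF m s(1)] by blast
  define I where "I = Dom C n"
  have nH: "n \<in> Hom C I Q" using n(2) by (simp add: I_def)
  have "has_torsion_sequence C U I"
    unfolding I_def using X[OF r(1)] Hom_sel(2,3)[OF r(2)] by metis
  then obtain a b where ab: "short_exact C a b" "Dom C a \<in> U" "b \<in> Hom C I (Cod C b)"
    "Cod C b \<in> right_perp C U"
    by (auto simp: has_torsion_sequence_def)
  have ka: "is_kernel C b a"
    using ab(1) by (simp add: short_exact_def)
  define A where "A = Dom C a"
  have a: "a \<in> Hom C A I" using kernel_in_Hom[OF ka ab(3)] by (simp add: A_def)
  have na: "n \<odot> a \<in> Hom C A Q" by (rule Comp_in_Hom[OF a nH])
  have mna: "monic C (n \<odot> a)" by (rule monic_Comp[OF kernel_monic[OF ka] kernel_monic[OF n(1)] a nH])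
  obtain w where w: "is_cokernel C (n \<odot> a) w" using ex_cokernel Hom_sel(1)[OF na] by blast
  note wH = cokernel_in_Hom[OF w na]
  have kw: "is_kernel C w (n \<odot> a)" by (rule monic_is_kernel[OF mna w])
  \<comment> \<open>Pull \<open>f\<close> back along \<open>w\<close>: the apex \<open>P\<close>
    extends \<open>Z\<close> by \<open>A\<close>, so it lies in \<open>U\<close>. Its arrow to
    \<open>Q\<close> lands in \<open>I\<close> by the case assumption, and then in \<open>A\<close>
    because the quotient of \<open>I\<close> by \<open>A\<close> is torsion-free; hence
    \<open>f\<close> dies on \<open>P\<close>.\<close>
  have "Cod C w \<in> right_perp C U"
  proof (rule right_perpI[OF Hom_objs(2)[OF wH]])
    show "U \<subseteq> Obj C" using torsD(1)[OF U] by (simp add: subcategory_def)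
    fix Z f assume Z: "Z \<in> U" and f: "f \<in> Hom C Z (Cod C w)"
    obtain p q where pb: "is_pullback C w f p q" and q: "epic C q"
      using ex_pullback_of_epic[OF wH f cokernel_epic[OF w]] by blast
    define P where "P = Dom C q"
    have qH: "q \<in> Hom C P Z" and pH: "p \<in> Hom C P Q" and wp: "w \<odot> p = f \<odot> q"
      using pb Hom_sel(2)[OF f] Hom_sel(2)[OF wH] by (auto simp: is_pullback_def P_def)
    obtain k where k: "is_kernel C q k" "Dom C k = Dom C (n \<odot> a)"
      using pullback_kernel[OF pb kw] by blast
    have P: "P \<in> U"
      by (rule tors_extension[OF U q k(1) _ qH Z]) (use k(2) Hom_sel(2)[OF na] ab(2) in \<open>simp add: A_def\<close>)
    have "s \<odot> p = ZeroArr C P S" using False P pH by blast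
    then obtain y where y: "y \<in> Hom C P I" "n \<odot> y = p"
      using kernel_factor[OF n(1) s(2) pH] unfolding I_def by blast
    have "b \<odot> y = ZeroArr C P (Cod C b)" by (rule right_perpD[OF ab(4) P Comp_in_Hom[OF y(1) ab(3)]])
    then obtain z where z: "z \<in> Hom C P A" "a \<odot> z = y"
      using kernel_factor[OF ka ab(3) y(1)] unfolding A_def by blast
    have "f \<odot> q = (w \<odot> (n \<odot> a)) \<odot> z"
      unfolding wp[symmetric] Comp_assoc[OF z(1) na wH] Comp_assoc[OF z(1) a nH] z(2) y(2) ..
    also have "\<dots> = ZeroArr C P (Cod C w)"
      using cokernel_zero[OF w na] zero_Comp[OF z(1)] Hom_objs[OF wH] by simp
    finally show "f = ZeroArr C Z (Cod C w)" using epic_zeroD[OF q qH f] by blast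
  qed
  moreover have "short_exact C (n \<odot> a) w" using w kw by (simp add: short_exact_def)
  moreover have "Dom C (n \<odot> a) \<in> U" using ab(2) Hom_sel(2)[OF na] by (simp add: A_def)
  ultimately show ?thesis using wH unfolding has_torsion_sequence_def by blast
qed

text \<open>The image of \<open>f\<close> is a subobject of a simple object, hence zero or
  everything; in the latter case the cokernel arrow of \<open>f\<close> is zero.\<close>

lemma simple_object_zero_or_epic:
  assumes S: "simple_object C S" and f: "f \<in> Hom C Z S"
  shows "f = ZeroArr C Z S \<or> epic C f"
proof -
  obtain c where c: "is_cokernel C f c" using ex_cokernel Hom_sel(1)[OF f] by blast
  note cH = cokernel_in_Hom[OF c f]
  obtain m e where m: "is_kernel C c m" "m \<in> Hom C (Dom C m) S" and e: "epic C e" "e \<in> Hom C Z (Dom C m)"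
    "m \<odot> e = f"
    using image_factorization[OF f c] by blast
  consider "zero_object C (Dom C m)" | "isomorphism C m"
    using S kernel_monic[OF m(1)] Hom_sel(3)[OF m(2)] by (auto simp: simple_object_def)
  then show ?thesis
  proof cases
    case 1
    then have "e = ZeroArr C Z (Dom C m)" using Ident_zeroD'[OF zero_object_Ident e(2)] by blast
    then show ?thesis using e(3) Comp_zero[OF m(2)] Hom_objs[OF e(2)] by simp
  next
    case 2
    then obtain g where g: "g \<in> Hom C S (Dom C m)" "m \<odot> g = Ident C S"
      using Hom_sel(3)[OF m(2)] by (auto simp: isomorphism_def)
    have "c = c \<odot> (m \<odot> g)" using g(2) Comp_Ident[OF cH] by simp
    also have "\<dots> = ZeroArr C S (Cod C c)"
      using Comp_assoc[OF g(1) m(2) cH] kernel_zero[OF m(1) cH] zero_Comp[OF g(1)] Hom_objs[OF cH]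
      by simp
    finally have c0: "c = ZeroArr C S (Cod C c)" .
    have "epic C f"
    proof (rule epicI[OF f])
      fix V h assume h: "h \<in> Hom C S V" "h \<odot> f = ZeroArr C Z V"
      obtain u where u: "u \<in> Hom C (Cod C c) V" "u \<odot> c = h"
        using cokernel_factor[OF c f h] by blast
      then show "h = ZeroArr C S V" using c0 Comp_zero[OF u(1)] Hom_objs[OF h(1)] by metis
    qed
    then show ?thesis ..
  qed
qed

text \<open>Unlike \<open>simple_object\<close>, the property allows zero objects and so survives in
  factor objects: pulling \<open>f\<close> back along \<open>t\<close> gives an arrow into
  \<open>S\<close>, and its alternative passes to \<open>f\<close> because \<open>q\<close> and
  \<open>t\<close> are epic.\<close>

lemma zero_or_epic_factor:
  assumes S: "\<And>Z f. f \<in> Hom C Z S \<Longrightarrow> f = ZeroArr C Z S \<or> epic C f"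
    and t: "epic C t" "t \<in> Hom C S S'" and f: "f \<in> Hom C Z S'"
  shows "f = ZeroArr C Z S' \<or> epic C f"
proof -
  obtain p q where pb: "is_pullback C t f p q" and q: "epic C q"
    using ex_pullback_of_epic[OF t(2) f t(1)] by blast
  define P where "P = Dom C q"
  have qH: "q \<in> Hom C P Z" and pH: "p \<in> Hom C P S" and tp: "t \<odot> p = f \<odot> q"
    using pb Hom_sel(2)[OF f] Hom_sel(2)[OF t(2)] by (auto simp: is_pullback_def P_def)
  from S[OF pH] show ?thesis
  proof
    assume "p = ZeroArr C P S"
    then have "f \<odot> q = ZeroArr C P S'" using tp Comp_zero[OF t(2)] Hom_objs[OF qH] by simp
    then show ?thesis using epic_zeroD[OF q qH f] by blast
  next
    assume "epic C p"
    then have "epic C (f \<odot> q)" using epic_Comp[OF _ t(1) pH t(2)] tp by simp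
    then show ?thesis using epic_CompD[OF _ qH f] by blast
  qed
qed

text \<open>
  Quantifying over all factor objects makes the induction go through: a factor object of an
  extension of \<open>S\<close> by \<open>X\<close> is an extension of a factor object of \<open>S\<close> by one of \<open>X\<close>.
\<close>

lemma composition_series_torsion_sequence:
  assumes U: "U \<in> tors C" and cs: "composition_series C X n Xs ms" and "j \<le> n"
    and "epic C e" "Dom C e = Xs j"
  shows "has_torsion_sequence C U (Cod C e)"
  using assms(3-)
proof (induction j arbitrary: e)
  \<comment> \<open>A factor object \<open>Q\<close> of a zero object has zero identity. Its torsion
    sequence is the identity of \<open>Q\<close> followed by the zero arrow of
    \<open>Q\<close>.\<close>
  case 0
  have Z0: "zero_object C (Dom C e)" using cs 0 by (simp add: composition_series_def)
  define Q where "Q = Cod C e"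
  have e: "e \<in> Hom C (Dom C e) Q" unfolding Q_def by (rule epic_in_Hom[OF 0(2)])
  have idQ: "Ident C Q \<in> Hom C Q Q" and z: "ZeroArr C Q Q \<in> Hom C Q Q"
    using Ident_in_Hom zero_in_Hom Hom_objs[OF e] by blast+
  have "Ident C Q \<odot> e = ZeroArr C (Dom C e) Q"
    using Ident_Comp[OF e] Ident_zeroD[OF zero_object_Ident[OF Z0] e] by simp
  then have Q: "Ident C Q = ZeroArr C Q Q" using epic_zeroD[OF 0(2) e idQ] by blast
  have zero_epic: "epic C f" if "f \<in> Hom C Y Q" for f Y
    by (rule epicI[OF that]) (rule Ident_zeroD[OF Q])
  have "is_kernel C (ZeroArr C Q Q) (Ident C Q)"
  proof (rule is_kernelI[OF z idQ])
    show "monic C (Ident C Q)" by (rule monicI[OF idQ]) (rule Ident_zeroD'[OF Q])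
    show "ZeroArr C Q Q \<odot> Ident C Q = ZeroArr C Q Q" by (rule Comp_Ident[OF z])
    show "\<exists>u \<in> Hom C Z Q. Ident C Q \<odot> u = h" if "h \<in> Hom C Z Q" for Z h
      using that Ident_Comp[OF that] by blast
  qed
  then have "short_exact C (Ident C Q) (ZeroArr C Q Q)" by (rule epic_short_exact[OF zero_epic[OF z]])
  moreover obtain Y where Y: "Y \<in> U" "U \<subseteq> Obj C" using torsD(1)[OF U] by (auto simp: subcategory_def)
  \<comment> \<open>Every arrow into \<open>Q\<close> is epic, so \<open>Q\<close> is a factor
    object of any member of \<open>U\<close>.\<close>
  have "ZeroArr C Y Q \<in> Hom C Y Q" using zero_in_Hom Y Hom_objs[OF e] by blast
  then have "Q \<in> U" using tors_factor[OF U zero_epic _ Y(1)] by blast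
  moreover have "Q \<in> right_perp C U"
    by (rule right_perpI[OF Hom_objs(2)[OF e] Y(2)]) (rule Ident_zeroD'[OF Q])
  ultimately show ?case
    unfolding has_torsion_sequence_def Q_def[symmetric]
    using z Hom_sel(3)[OF z] Hom_sel(2)[OF idQ] by metis
next
  case (Suc j)
  define Q where "Q = Cod C e"
  obtain q where mj: "ms j \<in> Hom C (Xs j) (Xs (Suc j))" and q: "is_cokernel C (ms j) q"
    "simple_object C (Cod C q)"
    using cs Suc.prems(1) by (auto simp: composition_series_def Suc_le_eq)
  note qH = cokernel_in_Hom[OF q(1) mj]
  have e: "e \<in> Hom C (Xs (Suc j)) Q" using epic_in_Hom[OF Suc.prems(2)] Suc.prems(3) Q_def by simp
  have m: "e \<odot> ms j \<in> Hom C (Xs j) Q" by (rule Comp_in_Hom[OF mj e])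
  \<comment> \<open>The cokernel object of \<open>e \<odot> ms j\<close> is a factor object of the
    simple \<open>Cod C q\<close>: the epic \<open>s \<odot> e\<close> kills \<open>ms j\<close> and
    so descends along \<open>q\<close> to an epic \<open>t\<close>.\<close>
  obtain s where s: "is_cokernel C (e \<odot> ms j) s" using ex_cokernel Hom_sel(1)[OF m] by blast
  note sH = cokernel_in_Hom[OF s m]
  have se: "s \<odot> e \<in> Hom C (Xs (Suc j)) (Cod C s)" by (rule Comp_in_Hom[OF e sH])
  have "(s \<odot> e) \<odot> ms j = ZeroArr C (Xs j) (Cod C s)"
    using Comp_assoc[OF mj e sH] cokernel_zero[OF s m] by simp
  then obtain t where t: "t \<in> Hom C (Cod C q) (Cod C s)" "t \<odot> q = s \<odot> e"
    using cokernel_factor[OF q(1) mj se] by blast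
  have "epic C (t \<odot> q)" using epic_Comp[OF Suc.prems(2) cokernel_epic[OF s] e sH] t(2) by simp
  then have et: "epic C t" using epic_CompD[OF _ qH t(1)] by blast
  have "f = ZeroArr C Z (Cod C s) \<or> epic C f" if "f \<in> Hom C Z (Cod C s)" for Z f
    using zero_or_epic_factor[OF simple_object_zero_or_epic[OF q(2)] et t(1) that] .
  then show ?case
    unfolding Q_def[symmetric]
    using has_torsion_sequence_extension[OF U m s sH] Suc.IH Suc.prems(1) by auto
qed

end

lemma (in abelian_length_category) ex_torsion_sequence:
  assumes U: "U \<in> tors C" and X: "X \<in> Obj C"
  shows "has_torsion_sequence C U X"
proof -
  obtain n Xs ms where cs: "composition_series C X n Xs ms" using ex_composition_series X by blast
  note I = Ident_in_Hom[OF X]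
  have "epic C (Ident C X)" by (rule epicI[OF I]) (simp add: Comp_Ident)
  then show ?thesis
    using composition_series_torsion_sequence[OF U cs order_refl] Hom_sel(2,3)[OF I] cs
    unfolding composition_series_def by metis
qed


section \<open>Wide and Serre subcategories\<close>

lemma Hom_full_subcategory:
  "X \<in> S \<Longrightarrow> Y \<in> S \<Longrightarrow> Hom (full_subcategory C S) X Y = Hom C X Y"
  by (auto simp: Hom_def full_subcategory_def)

lemma full_subcategory_sel [simp]:
  "Obj (full_subcategory C S) = S" "Dom (full_subcategory C S) = Dom C"
  "Cod (full_subcategory C S) = Cod C" "Ident (full_subcategory C S) = Ident C"
  "Comp (full_subcategory C S) = Comp C"
  by (simp_all add: full_subcategory_def)

lemma full_subcategory_preadditive_sel [simp]:
  "Add (full_subcategory C S) = Add C" "ZeroArr (full_subcategory C S) = ZeroArr C"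
  by (simp_all add: full_subcategory_def)

lemma Arr_full_subcategory [simp]:
  "f \<in> Arr (full_subcategory C S) \<longleftrightarrow> f \<in> Arr C \<and> Dom C f \<in> S \<and> Cod C f \<in> S"
  by (simp add: full_subcategory_def)

lemma subcategory_full_subcategory:
  assumes "subcategory C S" "S \<subseteq> W"
  shows "subcategory (full_subcategory C W) S"
  unfolding subcategory_def
proof (intro conjI allI impI)
  fix f assume f: "isomorphism (full_subcategory C W) f \<and> Dom (full_subcategory C W) f \<in> S"
  then have "f \<in> Arr C" "Dom C f \<in> W" "Cod C f \<in> W" by (auto simp: isomorphism_def)
  with f have "isomorphism C f" by (auto simp: isomorphism_def Hom_full_subcategory)
  with f assms(1) show "Cod (full_subcategory C W) f \<in> S" by (auto simp: subcategory_def)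
qed (use assms in \<open>auto simp: subcategory_def\<close>)

context abelian_category
begin

text \<open>The kernel of \<open>m\<close> formed in \<open>C\<close> lies in \<open>W\<close>, so
  it is available as a test arrow inside \<open>W\<close>; there \<open>m\<close> cannot tell it
  from zero, and a zero kernel makes \<open>m\<close> monic in \<open>C\<close>.\<close>

lemma monic_full_subcategory:
  assumes W: "closed_under_kernels C W" and m: "monic (full_subcategory C W) m"
  shows "monic C m"
proof -
  have mW: "m \<in> Arr C" "Dom C m \<in> W" "Cod C m \<in> W" using m by (auto simp: monic_def)
  note mH = HomI[OF mW(1)]
  obtain k where k: "is_kernel C m k" using ex_kernel mW(1) by blast
  note kH = kernel_in_Hom[OF k mH]
  have KW: "Dom C k \<in> W" using W k mW by (auto simp: closed_under_kernels_def)
  have z: "ZeroArr C (Dom C k) (Dom C m) \<in> Hom C (Dom C k) (Dom C m)"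
    using zero_in_Hom Hom_objs[OF kH] by blast
  have k0: "k = ZeroArr C (Dom C k) (Dom C m)"
  proof (rule monicD[OF m, where X = "Dom C m" and Y = "Cod C m" and Z = "Dom C k"])
    show "m \<odot>\<^bsub>full_subcategory C W\<^esub> k =
        m \<odot>\<^bsub>full_subcategory C W\<^esub> ZeroArr C (Dom C k) (Dom C m)"
      using kernel_zero[OF k mH] Comp_zero[OF mH] Hom_objs[OF kH] by simp
  qed (use mH kH z mW KW in \<open>simp_all add: Hom_full_subcategory\<close>)
  show ?thesis
  proof (rule monicI[OF mH])
    fix Z h assume h: "h \<in> Hom C Z (Dom C m)" "m \<odot> h = ZeroArr C Z (Cod C m)"
    obtain u where u: "u \<in> Hom C Z (Dom C k)" "k \<odot> u = h" using kernel_factor[OF k mH h] by blast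
    have "k \<odot> u = ZeroArr C Z (Dom C m)" by (subst k0) (rule zero_Comp[OF u(1) Hom_objs(2)[OF kH]])
    then show "h = ZeroArr C Z (Dom C m)" using u(2) by simp
  qed
qed

text \<open>The kernel \<open>l\<close> formed in \<open>C\<close> lies in \<open>W\<close>, so
  \<open>k\<close> and \<open>l\<close> factor through each other and \<open>k\<close> inherits the
  universal property of \<open>l\<close> against all objects of \<open>C\<close>.\<close>

lemma is_kernel_full_subcategory:
  assumes W: "closed_under_kernels C W" and k: "is_kernel (full_subcategory C W) f k"
  shows "is_kernel C f k"
proof -
  have fW: "f \<in> Arr C" "Dom C f \<in> W" "Cod C f \<in> W" and kW: "k \<in> Arr C" "Dom C k \<in> W"
    and kf: "Cod C k = Dom C f" and fk: "f \<odot> k = ZeroArr C (Dom C k) (Cod C f)"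
    using k by (auto simp: is_kernel_def)
  note fH = HomI[OF fW(1)]
  have kH: "k \<in> Hom C (Dom C k) (Dom C f)" using HomI[OF kW(1)] kf by simp
  have fH': "f \<in> Hom (full_subcategory C W) (Dom C f) (Cod C f)"
    using fH fW by (simp add: Hom_full_subcategory)
  obtain l where l: "is_kernel C f l" using ex_kernel fW(1) by blast
  note lH = kernel_in_Hom[OF l fH]
  have lW: "Dom C l \<in> W" using W l fW by (auto simp: closed_under_kernels_def)
  obtain v where v: "v \<in> Hom C (Dom C l) (Dom C k)" "k \<odot> v = l"
    using kernel_factor[OF k fH', of l "Dom C l"] kernel_zero[OF l fH] lH lW fW kW
    by (auto simp: Hom_full_subcategory)
  have mono: "monic C k"
  proof (rule monicI[OF kH])
    fix Z h assume h: "h \<in> Hom C Z (Dom C k)" "k \<odot> h = ZeroArr C Z (Dom C f)"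
    obtain u where u: "u \<in> Hom C (Dom C k) (Dom C l)" "l \<odot> u = k"
      using kernel_factor[OF l fH kH fk] by blast
    have vu: "v \<odot> u \<in> Hom C (Dom C k) (Dom C k)" by (rule Comp_in_Hom[OF u(1) v(1)])
    have kvu: "k \<odot> (v \<odot> u) = k" using Comp_assoc[OF u(1) v(1) kH] u v by simp
    have "k \<in> Hom (full_subcategory C W) (Dom C k) (Dom C f)"
      using kH fW kW by (simp add: Hom_full_subcategory)
    \<comment> \<open>\<open>k\<close> factors through itself in only one way inside
      \<open>W\<close>, so \<open>v \<odot> u\<close> is the identity and \<open>k\<close> is monic
      in \<open>C\<close> because \<open>l\<close> is.\<close>
    then have "\<exists>!w. w \<in> Hom (full_subcategory C W) (Dom C k) (Dom C k) \<and> k \<odot> w = k"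
      using k fk unfolding is_kernel_def full_subcategory_sel full_subcategory_preadditive_sel
      by blast
    then have "\<exists>!w. w \<in> Hom C (Dom C k) (Dom C k) \<and> k \<odot> w = k"
      unfolding Hom_full_subcategory[OF kW(2) kW(2)] .
    moreover have "Ident C (Dom C k) \<in> Hom C (Dom C k) (Dom C k)"
      by (rule Ident_in_Hom[OF Hom_objs(1)[OF kH]])
    ultimately have "v \<odot> u = Ident C (Dom C k)" using vu kvu Comp_Ident[OF kH] by blast
    then have "h = v \<odot> (u \<odot> h)" using Comp_assoc[OF h(1) u(1) v(1)] Ident_Comp[OF h(1)] by simp
    moreover have "u \<odot> h = ZeroArr C Z (Dom C l)"
      by (rule monic_zeroD[OF kernel_monic[OF l] lH Comp_in_Hom[OF h(1) u(1)]])
        (use Comp_assoc[OF h(1) u(1) lH] u(2) h(2) in simp)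
    ultimately show "h = ZeroArr C Z (Dom C k)"
      using Comp_zero[OF v(1)] Hom_objs[OF h(1)] by simp
  qed
  show ?thesis
  proof (rule is_kernelI[OF fH kH mono fk])
    fix Z h assume h: "h \<in> Hom C Z (Dom C f)" "f \<odot> h = ZeroArr C Z (Cod C f)"
    obtain w where w: "w \<in> Hom C Z (Dom C l)" "l \<odot> w = h" using kernel_factor[OF l fH h] by blast
    have "k \<odot> (v \<odot> w) = h" using Comp_assoc[OF w(1) v(1) kH] v(2) w(2) by simp
    then show "\<exists>u \<in> Hom C Z (Dom C k). k \<odot> u = h" using Comp_in_Hom[OF w(1) v(1)] by blast
  qed
qed

lemma epic_full_subcategory:
  assumes "closed_under_cokernels C W" "epic (full_subcategory C W) e"
  shows "epic C e"
  using abelian_category.monic_full_subcategory[OF abelian_category_opposite[OF abelian_category_axioms],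
      of W e] assms
  by (simp add: closed_under_kernels_def closed_under_cokernels_def full_subcategory_opposite conj_commute
      conj_left_commute)

lemma is_cokernel_full_subcategory:
  assumes "closed_under_cokernels C W" "is_cokernel (full_subcategory C W) f c"
  shows "is_cokernel C f c"
  using abelian_category.is_kernel_full_subcategory[OF abelian_category_opposite[OF abelian_category_axioms],
      of W f c] assms
  by (simp add: closed_under_kernels_def closed_under_cokernels_def full_subcategory_opposite conj_commute
      conj_left_commute)

text \<open>Since \<open>k\<close> is monic, an arrow \<open>g\<close> into the kernel object has
  the same kernel as \<open>k \<odot> g\<close>, which ends in a member of
  \<open>W_L C T\<close>.\<close>

lemma W_L_closed_under_kernels:
  assumes T: "T \<in> tors C"
  shows "closed_under_kernels C (W_L C T)"
  unfolding closed_under_kernels_def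
proof (intro allI impI, elim conjE)
  fix f k assume X: "Dom C f \<in> W_L C T" and Y: "Cod C f \<in> W_L C T" and k: "is_kernel C f k"
  have f: "f \<in> Hom C (Dom C f) (Cod C f)" using k by (simp add: is_kernel_def Hom_def)
  note kH = kernel_in_Hom[OF k f]
  have KT: "Dom C k \<in> T" using X Y f k unfolding W_L_def by blast
  moreover have "Dom C l \<in> T" if Z: "Z \<in> T" and g: "g \<in> Hom C Z (Dom C k)" and l: "is_kernel C g l" for Z g l
  proof -
    note lH = kernel_in_Hom[OF l g]
    have kg: "k \<odot> g \<in> Hom C Z (Dom C f)" by (rule Comp_in_Hom[OF g kH])
    have "is_kernel C (k \<odot> g) l"
    proof (rule is_kernelI[OF kg lH kernel_monic[OF l]])
      show "(k \<odot> g) \<odot> l = ZeroArr C (Dom C l) (Dom C f)"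
        using Comp_assoc[OF lH g kH] kernel_zero[OF l g] Comp_zero[OF kH] Hom_objs[OF lH] by simp
      fix V h assume h: "h \<in> Hom C V Z" "(k \<odot> g) \<odot> h = ZeroArr C V (Dom C f)"
      have "g \<odot> h = ZeroArr C V (Dom C k)"
        by (rule monic_zeroD[OF kernel_monic[OF k] kH Comp_in_Hom[OF h(1) g]])
          (use Comp_assoc[OF h(1) g kH] h(2) in simp)
      then show "\<exists>u \<in> Hom C V (Dom C l). l \<odot> u = h" using kernel_factor[OF l g h(1)] by blast
    qed
    then show ?thesis using X Z kg unfolding W_L_def by blast
  qed
  ultimately show "Dom C k \<in> W_L C T" unfolding W_L_def by blast
qed

text \<open>Pull \<open>g\<close> back along \<open>c\<close>. The apex extends \<open>Z\<close> by
  the image of \<open>f\<close>, so it lies in \<open>T\<close>; its projection to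
  \<open>Cod C f\<close> has the same kernel object as \<open>g\<close>, and the membership of
  \<open>Cod C f\<close> in \<open>W_L C T\<close> puts that object into \<open>T\<close>.\<close>

lemma W_L_closed_under_cokernels:
  assumes T: "T \<in> tors C"
  shows "closed_under_cokernels C (W_L C T)"
  unfolding closed_under_cokernels_def
proof (intro allI impI, elim conjE)
  fix f c assume X: "Dom C f \<in> W_L C T" and Y: "Cod C f \<in> W_L C T" and c: "is_cokernel C f c"
  have f: "f \<in> Hom C (Dom C f) (Cod C f)" using c by (simp add: is_cokernel_def Hom_def)
  note cH = cokernel_in_Hom[OF c f]
  have XT: "Dom C f \<in> T" and YT: "Cod C f \<in> T" using X Y by (auto simp: W_L_def)
  have CT: "Cod C c \<in> T" by (rule tors_factor[OF T cokernel_epic[OF c] cH YT])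
  obtain m e where m: "is_kernel C c m" and e: "epic C e" "e \<in> Hom C (Dom C f) (Dom C m)"
    using image_factorization[OF f c] by blast
  have IT: "Dom C m \<in> T" by (rule tors_factor[OF T e XT])
  have "Dom C l \<in> T" if Z: "Z \<in> T" and g: "g \<in> Hom C Z (Cod C c)" and l: "is_kernel C g l" for Z g l
  proof -
    obtain p q where pb: "is_pullback C c g p q" and q: "epic C q"
      using ex_pullback_of_epic[OF cH g cokernel_epic[OF c]] by blast
    have qH: "q \<in> Hom C (Dom C q) Z" and pH: "p \<in> Hom C (Dom C q) (Cod C f)"
      using pb Hom_sel(2)[OF g] Hom_sel(2)[OF cH] by (auto simp: is_pullback_def)
    obtain k where "is_kernel C q k" "Dom C k = Dom C m" using pullback_kernel[OF pb m] by blast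
    then have PT: "Dom C q \<in> T" using tors_extension[OF T q _ _ qH Z] IT by simp
    obtain k' where "is_kernel C p k'" "Dom C k' = Dom C l"
      using pullback_kernel[OF is_pullback_commute[OF pb] l] by blast
    then show ?thesis using Y PT pH unfolding W_L_def by fastforce
  qed
  then show "Cod C c \<in> W_L C T" using CT unfolding W_L_def by blast
qed

end

lemma (in additive_category) zero_object_in_tors:
  assumes T: "T \<in> tors C" and Z0: "zero_object C Z0"
  shows "Z0 \<in> T"
proof -
  obtain Y where Y: "Y \<in> T" "Y \<in> Obj C" using torsD(1)[OF T] by (auto simp: subcategory_def)
  have z: "ZeroArr C Y Z0 \<in> Hom C Y Z0" using zero_in_Hom Y Z0 by (simp add: zero_object_def)
  have "epic C (ZeroArr C Y Z0)"
    by (rule epicI[OF z]) (rule Ident_zeroD[OF zero_object_Ident[OF Z0]])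
  then show ?thesis using tors_factor[OF T _ z Y(1)] by blast
qed

text \<open>
  A torsion-free class \<open>F\<close> is a torsion class of the opposite category, so that passing to the
  opposite category exchanges the roles of \<open>T\<close> and \<open>F\<close>.
\<close>

locale tors_torsion_free = abelian_category C
  for C :: "('o, 'a, 'm) preadditive_scheme" (structure) +
  fixes T F :: "'o set"
  assumes T: "T \<in> tors C" and F: "F \<in> tors (opposite C)"
begin

lemma dual: "tors_torsion_free (opposite C) F T"
  by (intro tors_torsion_free.intro tors_torsion_free_axioms.intro
      abelian_category_opposite abelian_category_axioms) (simp_all add: T F)

lemma F_subobject: "monic C m \<Longrightarrow> m \<in> Hom C X Y \<Longrightarrow> Y \<in> F \<Longrightarrow> X \<in> F"
  using tors_factor[OF F] by simp

lemma subcategory_Int: "subcategory C (F \<inter> T)"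
proof -
  obtain Z0 where Z0: "zero_object C Z0" using ex_zero_object by blast
  have "Z0 \<in> F"
    using additive_category.zero_object_in_tors[OF additive_category_opposite[OF additive_category_axioms] F]
      Z0 by simp
  then have "F \<inter> T \<noteq> {}" using zero_object_in_tors[OF T Z0] by blast
  then show ?thesis
    using torsD(1)[OF T] torsD(1)[OF F] unfolding subcategory_opposite by (auto simp: subcategory_def)
qed

lemma closed_under_extensions_Int: "closed_under_extensions C (F \<inter> T)"
  using torsD(2)[OF T] torsD(2)[OF F] unfolding closed_under_extensions_opposite
  by (auto simp: closed_under_extensions_def)

lemma closed_under_kernels_Int:
  assumes "F \<inter> T \<subseteq> W_L C T"
  shows "closed_under_kernels C (F \<inter> T)"
  unfolding closed_under_kernels_def
proof (intro allI impI, elim conjE)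
  fix f k assume X: "Dom C f \<in> F \<inter> T" and Y: "Cod C f \<in> F \<inter> T" and k: "is_kernel C f k"
  have f: "f \<in> Hom C (Dom C f) (Cod C f)" using k by (simp add: is_kernel_def Hom_def)
  have "Dom C k \<in> T" using Y assms X f k unfolding W_L_def by blast
  moreover have "Dom C k \<in> F"
    using F_subobject[OF kernel_monic[OF k] kernel_in_Hom[OF k f]] X by blast
  ultimately show "Dom C k \<in> F \<inter> T" by blast
qed

text \<open>The inclusion enters as a hypothesis because it rests on torsion sequences, which come
  from \<open>U\<close> in \<open>C\<close> and from \<open>T\<close> in the dual reading, whereas
  the rest of the argument is the same for both.\<close>

lemma wide_iff_Serre_in_W_L:
  assumes W_L: "wide C (F \<inter> T) \<Longrightarrow> F \<inter> T \<subseteq> W_L C T"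
  shows "wide C (F \<inter> T) \<longleftrightarrow> F \<inter> T \<in> Serre_in C (W_L C T)"
proof
  assume wide: "wide C (F \<inter> T)"
  note sub = W_L[OF wide] and ker = W_L_closed_under_kernels[OF T]
    and coker = W_L_closed_under_cokernels[OF T]
  have "closed_under_extensions (full_subcategory C (W_L C T)) (F \<inter> T)"
    unfolding closed_under_extensions_def full_subcategory_sel
  proof (intro allI impI, elim conjE)
    fix f g assume fg: "short_exact (full_subcategory C (W_L C T)) f g"
      and *: "Dom C f \<in> F \<inter> T" "Cod C g \<in> F \<inter> T"
    have "short_exact C f g"
      using fg is_kernel_full_subcategory[OF ker] is_cokernel_full_subcategory[OF coker]
      unfolding short_exact_def by blast
    then show "Cod C f \<in> F \<inter> T"
      using closed_under_extensions_Int * unfolding closed_under_extensions_def by blast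
  qed
  moreover have "closed_under_factors (full_subcategory C (W_L C T)) (F \<inter> T)"
    unfolding closed_under_factors_def full_subcategory_sel
  proof (intro allI impI, elim conjE)
    fix e assume e: "epic (full_subcategory C (W_L C T)) e" and X: "Dom C e \<in> F \<inter> T"
    have eW: "e \<in> Arr C" "Dom C e \<in> W_L C T" "Cod C e \<in> W_L C T" using e by (auto simp: epic_def)
    have ep: "epic C e" by (rule epic_full_subcategory[OF coker e])
    obtain k where k: "is_kernel C e k" using ex_kernel eW(1) by blast
    note kH = kernel_in_Hom[OF k HomI[OF eW(1)]]
    \<comment> \<open>The kernel lies in \<open>T\<close> through \<open>W_L C T\<close> and in
      \<open>F\<close> as a subobject, so \<open>e\<close> is the cokernel of an arrow within
      \<open>F \<inter> T\<close> and wideness applies.\<close>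
    have "Dom C k \<in> W_L C T" using ker k eW unfolding closed_under_kernels_def by blast
    then have "Dom C k \<in> F \<inter> T" using F_subobject[OF kernel_monic[OF k] kH] X by (auto simp: W_L_def)
    then show "Cod C e \<in> F \<inter> T"
      using wide X epic_is_cokernel[OF ep k] Hom_sel(3)[OF kH]
      unfolding wide_def closed_under_cokernels_def by metis
  qed
  moreover have "closed_under_subobjects (full_subcategory C (W_L C T)) (F \<inter> T)"
    unfolding closed_under_subobjects_def full_subcategory_sel
  proof (intro allI impI, elim conjE)
    fix m assume m: "monic (full_subcategory C (W_L C T)) m" and Y: "Cod C m \<in> F \<inter> T"
    have mc: "monic C m" by (rule monic_full_subcategory[OF ker m])
    have "Dom C m \<in> T" using m by (auto simp: monic_def W_L_def)
    then show "Dom C m \<in> F \<inter> T" using F_subobject[OF mc monic_in_Hom[OF mc]] Y by blast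
  qed
  ultimately show "F \<inter> T \<in> Serre_in C (W_L C T)"
    using subcategory_full_subcategory[OF subcategory_Int sub] by (simp add: Serre_in_def Serre_def)
next
  assume "F \<inter> T \<in> Serre_in C (W_L C T)"
  then have sub: "F \<inter> T \<subseteq> W_L C T"
    and fac: "closed_under_factors (full_subcategory C (W_L C T)) (F \<inter> T)"
    by (auto simp: Serre_in_def Serre_def subcategory_def)
  have "closed_under_cokernels C (F \<inter> T)"
    unfolding closed_under_cokernels_def
  proof (intro allI impI, elim conjE)
    fix f c assume X: "Dom C f \<in> F \<inter> T" and Y: "Cod C f \<in> F \<inter> T" and c: "is_cokernel C f c"
    have "Cod C c \<in> W_L C T"
      using W_L_closed_under_cokernels[OF T] X Y c sub unfolding closed_under_cokernels_def by blast
    moreover have cD: "c \<in> Arr C" "Dom C c = Cod C f" using c by (auto simp: is_cokernel_def)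
    \<comment> \<open>An epimorphism of \<open>C\<close> with both ends in the full subcategory
      stays epic there, so closure under factor objects yields closure under cokernels.\<close>
    ultimately have "epic (full_subcategory C (W_L C T)) c"
      using cokernel_epic[OF c] Y sub unfolding epic_def by (auto simp: Hom_def)
    then show "Cod C c \<in> F \<inter> T"
      using fac Y cD(2) unfolding closed_under_factors_def full_subcategory_sel by metis
  qed
  then show "wide C (F \<inter> T)"
    using subcategory_Int closed_under_extensions_Int closed_under_kernels_Int[OF sub]
    by (simp add: wide_def)
qed

text \<open>The hypothesis \<open>seq\<close> states a torsion sequence without naming
  \<open>U\<close>, so the lemma also serves in the opposite category, where the sequence is that of
  \<open>T\<close> read backwards.\<close>

lemma wide_subset_W_L:
  assumes wide: "wide C (F \<inter> T)"
    and seq: "\<And>Y. Y \<in> T \<Longrightarrow> \<exists>a b. short_exact C a b \<and> Dom C a \<in> T \<and> b \<in> Hom C Y (Cod C b) \<and>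
      Cod C b \<in> F \<and> (\<forall>X \<in> F. \<forall>f \<in> Hom C (Dom C a) X. f = ZeroArr C (Dom C a) X)"
  shows "F \<inter> T \<subseteq> W_L C T"
proof
  fix X assume X: "X \<in> F \<inter> T"
  have "Dom C k \<in> T" if Y: "Y \<in> T" and g: "g \<in> Hom C Y X" and k: "is_kernel C g k" for Y g k
  proof -
    obtain a b where ab: "short_exact C a b" "Dom C a \<in> T" "b \<in> Hom C Y (Cod C b)" "Cod C b \<in> F"
      and zero: "\<And>f. f \<in> Hom C (Dom C a) X \<Longrightarrow> f = ZeroArr C (Dom C a) X"
      using seq[OF Y] X by blast
    have ka: "is_kernel C b a" and cb: "is_cokernel C a b"
      using ab(1) by (simp_all add: short_exact_def)
    note a = kernel_in_Hom[OF ka ab(3)]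
    obtain h where h: "h \<in> Hom C (Cod C b) X" "h \<odot> b = g"
      using cokernel_factor[OF cb a g zero[OF Comp_in_Hom[OF a g]]] by blast
    have B: "Cod C b \<in> F \<inter> T" using tors_factor[OF T cokernel_epic[OF cb] ab(3) Y] ab(4) by blast
    obtain l where l: "is_kernel C h l" using ex_kernel Hom_sel(1)[OF h(1)] by blast
    note lH = kernel_in_Hom[OF l h(1)]
    have LT: "Dom C l \<in> T"
      using wide l B X unfolding wide_def closed_under_kernels_def Hom_sel(2,3)[OF h(1), symmetric]
      by blast
    \<comment> \<open>The preimage of the kernel of \<open>h\<close> under \<open>b\<close> is a
      kernel of \<open>g\<close>, and it extends \<open>Dom C l\<close> by \<open>Dom C a\<close>,
      both of which lie in \<open>T\<close>.\<close>
    obtain p q where pb: "is_pullback C b l p q" and q: "epic C q"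
      using ex_pullback_of_epic[OF ab(3) lH cokernel_epic[OF cb]] by blast
    have qH: "q \<in> Hom C (Dom C q) (Dom C l)" and pH: "p \<in> Hom C (Dom C q) Y"
      using pb Hom_sel(2)[OF ab(3)] by (auto simp: is_pullback_def)
    obtain a' where "is_kernel C q a'" "Dom C a' = Dom C a" using pullback_kernel[OF pb ka] by blast
    then have PT: "Dom C q \<in> T" using tors_extension[OF T q _ _ qH LT] ab(2) by simp
    have "is_kernel C (h \<odot> b) p"
      by (rule pullback_kernel_Comp[OF pb l]) (use h(1) Hom_sel(3)[OF lH] in simp)
    then show ?thesis
      using kernel_Dom_iso[OF _ k torsD(1)[OF T], of p] h(2) PT Hom_sel(2)[OF pH] by simp
  qed
  then show "X \<in> W_L C T" using X unfolding W_L_def by blast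
qed

end

section \<open>Equivalence of the four conditions\<close>

theorem theorem6p6:
  fixes C :: "('o, 'a, 'm) preadditive_scheme"
    and U T W :: "'o set"
  assumes "abelian_length_category C"
    and "U \<in> tors C" and "T \<in> tors C" and "U \<subseteq> T"
    and "W = right_perp C U \<inter> T"
  shows "(wide C W \<longleftrightarrow> W \<in> Serre_in C (W_L C T)) \<and>
    (wide C W \<longleftrightarrow> W \<in> Serre_in C (W_R C (right_perp C U))) \<and>
    (wide C W \<longleftrightarrow> W = W_R C (right_perp C U) \<inter> W_L C T)"
proof -
  interpret abelian_length_category C by fact
  define F where "F = right_perp C U"
  have UObj: "U \<subseteq> Obj C" and TObj: "T \<subseteq> Obj C"
    using torsD(1)[OF assms(2)] torsD(1)[OF assms(3)] by (auto simp: subcategory_def)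
  have FObj: "F \<subseteq> Obj C" by (auto simp: F_def right_perp_def)
  interpret TF: tors_torsion_free C T F
    by (intro tors_torsion_free.intro tors_torsion_free_axioms.intro abelian_category_axioms)
      (simp_all add: assms(3) F_def right_perp_tors_opposite[OF UObj])
  interpret op: tors_torsion_free "opposite C" F T by (rule TF.dual)
  have W: "F \<inter> T = W" "T \<inter> F = W" using assms(5) F_def by blast+
  \<comment> \<open>The sequence needed is that of \<open>U\<close>; \<open>U \<subseteq> T\<close>
    places the torsion part of \<open>Y\<close> in \<open>T\<close>.\<close>
  have L: "F \<inter> T \<subseteq> W_L C T" if "wide C (F \<inter> T)"
  proof (rule TF.wide_subset_W_L[OF that])
    fix Y assume "Y \<in> T"
    then have "has_torsion_sequence C U Y" using ex_torsion_sequence[OF assms(2)] TObj by blast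
    then obtain a b where ab: "short_exact C a b" "Dom C a \<in> U" "b \<in> Hom C Y (Cod C b)" "Cod C b \<in> F"
      unfolding has_torsion_sequence_def F_def by blast
    have "f = ZeroArr C (Dom C a) X" if "X \<in> F" "f \<in> Hom C (Dom C a) X" for X f
      using right_perpD[of X C U, OF _ ab(2)] that by (simp add: F_def)
    then show "\<exists>a b. short_exact C a b \<and> Dom C a \<in> T \<and> b \<in> Hom C Y (Cod C b) \<and>
      Cod C b \<in> F \<and> (\<forall>X \<in> F. \<forall>f \<in> Hom C (Dom C a) X. f = ZeroArr C (Dom C a) X)"
      using ab assms(4) by blast
  qed
  \<comment> \<open>Dually, an object of \<open>F\<close> is cut by \<open>T\<close>: in the
    opposite category its torsion-free quotient becomes the subobject and its
    \<open>T\<close>-torsion part the quotient.\<close>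
  have R: "T \<inter> F \<subseteq> W_L (opposite C) F" if "wide (opposite C) (T \<inter> F)"
  proof (rule op.wide_subset_W_L[OF that])
    fix Y assume "Y \<in> F"
    then have "has_torsion_sequence C T Y" using ex_torsion_sequence[OF assms(3)] FObj by blast
    then obtain a b where ab: "short_exact C a b" "Dom C a \<in> T" "b \<in> Hom C Y (Cod C b)"
      "Cod C b \<in> right_perp C T"
      unfolding has_torsion_sequence_def by blast
    \<comment> \<open>What is orthogonal to \<open>T\<close> is orthogonal to the smaller class
      \<open>U\<close>.\<close>
    have "Cod C b \<in> F" using ab(4) assms(4) by (auto simp: F_def right_perp_def)
    moreover have "a \<in> Hom C (Dom C a) Y"
      using ab(1) kernel_in_Hom[OF _ ab(3)] by (simp add: short_exact_def)
    ultimately have "short_exact (opposite C) b a \<and> Dom (opposite C) b \<in> F \<and>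
      a \<in> Hom (opposite C) Y (Cod (opposite C) a) \<and> Cod (opposite C) a \<in> T \<and>
      (\<forall>X \<in> T. \<forall>f \<in> Hom (opposite C) (Dom (opposite C) b) X.
        f = ZeroArr (opposite C) (Dom (opposite C) b) X)"
      using ab right_perpD[OF ab(4)] by simp
    then show "\<exists>a b. short_exact (opposite C) a b \<and> Dom (opposite C) a \<in> F \<and>
      b \<in> Hom (opposite C) Y (Cod (opposite C) b) \<and> Cod (opposite C) b \<in> T \<and>
      (\<forall>X \<in> T. \<forall>f \<in> Hom (opposite C) (Dom (opposite C) a) X.
        f = ZeroArr (opposite C) (Dom (opposite C) a) X)" by blast
  qed
  have "wide C W \<longleftrightarrow> W \<in> Serre_in C (W_L C T)"
    using TF.wide_iff_Serre_in_W_L[OF L] unfolding W .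
  moreover have "wide C W \<longleftrightarrow> W \<in> Serre_in C (W_R C F)"
    using op.wide_iff_Serre_in_W_L[OF R] unfolding W W_L_opposite wide_opposite Serre_in_opposite .
  moreover have "wide C W \<longleftrightarrow> W = W_R C F \<inter> W_L C T"
  proof
    assume "wide C W"
    then have "W \<subseteq> W_L C T" "W \<subseteq> W_R C F" using L R unfolding W W_L_opposite wide_opposite by blast+
    moreover have "W_R C F \<inter> W_L C T \<subseteq> W" unfolding W(1)[symmetric] by (auto simp: W_R_def W_L_def)
    ultimately show "W = W_R C F \<inter> W_L C T" by blast
  next
    assume "W = W_R C F \<inter> W_L C T"
    then have "W \<subseteq> W_L C T" "W \<subseteq> W_R C F" by blast+
    \<comment> \<open>Kernels are controlled by the inclusion in \<open>W_L C T\<close>, cokernels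
      by the one in \<open>W_R C F\<close> read in the opposite category.\<close>
    then have "closed_under_kernels C W" "closed_under_kernels (opposite C) W"
      using TF.closed_under_kernels_Int op.closed_under_kernels_Int unfolding W W_L_opposite by blast+
    moreover have "closed_under_kernels (opposite C) W = closed_under_cokernels C W"
      by (auto simp: closed_under_kernels_def closed_under_cokernels_def)
    ultimately show "wide C W"
      using TF.subcategory_Int TF.closed_under_extensions_Int unfolding W wide_def by blast
  qed
  ultimately show ?thesis unfolding F_def by blast
qed

end
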